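(* Fix $\sigma>0$, integers $d\ge2$ and $m$, a matrix $A\in\mathbb{R}^{m\times d}$ with $\mathrm{rank}(A)=m$, and $e\in\mathbb{R}^d$ with $\|e\|=1$ and $Ae\ne0$. Let $(\sigma_t)_{t\in[0,1]}\subseteq[\sigma_{\min},\sigma_{\max}]$ be any bounded (measurable) noise schedule with $0<\sigma_{\min}<\sigma_{\max}<\infty$. For $u\in\mathbb{R}^d\setminus\{0\}$ put $\theta(u)=(u,u/\|u\|)$ and consider $$\mathcal{L}(\theta(u))=\mathbb{E}_{t\sim\mathrm{Unif}[0,1]}\,\mathbb{E}_{y_t\sim\tilde p^{\sigma_t}_{G_{\theta(u)}}}\left[\left\|s_{A,\sigma^2+\sigma_t^2}(y_t)-\nabla\log\tilde p^{\sigma_t}_{G_{\theta(u)}}(y_t)\right\|_2^2\right],$$ where $s_{A,\tau}(y)=-(Aee^TA^T+\tau I_m)^{-1}y$ for $\tau>0$ and $\tilde p^{\sigma_t}_{G_{\theta(u)}}=\mathcal{N}(0,Auu^TA^T+\sigma_t^2I_m)$. Then the set of global minimizers of $u\mapsto\mathcal{L}(\theta(u))$ is $$\Theta_*:=\left\{\pm\sqrt{1+\frac{\sigma^2}{\|Ae\|^2}}\cdot e\right\}+\ker(A).$$ If moreover $e\in\mathrm{Im}(A^T)$, then for any minimum norm solution $u_*\in\arg\min_{u\in\Theta_*}\|u\|$, with $\theta_*=\theta(u_* )$, $$W_2^2(p_X,p_{G_{\theta_*}})=\left(\sqrt{1+\frac{\sigma^2}{\|Ae\|^2}}-1\right)^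2.$$
   Context: Here the clean distribution is $p_X=\mathcal{N}(0,ee^T)$ on $\mathbb{R}^d$ and the observations are $y=Ax+\sigma\epsilon$, $x\sim p_X$, $\epsilon\sim\mathcal{N}(0,I_m)$, with law $\mathcal{N}(0,Aee^TA^T+\sigma^2I_m)$. For $\theta=(U,V)$ with $U,V\in\mathbb{R}^{d}$, the generator is $G_\theta(z)=UV^Tz$, $z\sim\mathcal{N}(0,I_d)$, with law $p_{G_\theta}=\mathcal{N}(0,UV^TVU^T)$; so $p_{G_{\theta(u)}}=\mathcal{N}(0,uu^T)$. $\tilde p^{\sigma_t}_{G_\theta}$ is the law of $AG_\theta(z)+\sigma_t\epsilon$ with $\epsilon\sim\mathcal{N}(0,I_m)$ independent of $z$. $W_2$ is the Wasserstein-2 distance, $\|\cdot\|$ the Euclidean norm, and for a set $S$, $S+\ker(A)=\{s+q:s\in S,\ q\in\ker(A)\}$. *)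

theory Defs
  imports "HOL-Probability.Probability"
begin

definition outer :: "real^'n \<Rightarrow> real^'k \<Rightarrow> real^'k^'n" where
  "outer u v = (\<chi> i j. u $ i * v $ j)"

definition std_gaussian :: "(real^'n) measure" where
  "std_gaussian = density lborel (\<lambda>z. ennreal (\<Prod>i\<in>UNIV. std_normal_density (z $ i)))"

(* N(0, S) for positive semidefinite S, which may be singular: the law of L z with z standard
   normal and L L^T = S. Such an L exists exactly for symmetric positive semidefinite S, and the
   law does not depend on which one is chosen. *)
definition centered_gaussian :: "real^'n^'n \<Rightarrow> (real^'n) measure" where
  "centered_gaussian S =
     distr std_gaussian borel (\<lambda>z. (SOME L :: real^'n^'n. L ** transpose L = S) *v z)"

definition couplings :: "'a measure \<Rightarrow> 'b measure \<Rightarrow> ('a \<times> 'b) measure set" where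
  "couplings P Q = {\<pi>. sets \<pi> = sets (P \<Otimes>\<^sub>M Q) \<and> distr \<pi> P fst = P \<and> distr \<pi> Q snd = Q}"

(* The infimum of the transport cost is taken in the extended nonnegative reals. The conversion
   to the reals is only meaningful when it is finite, e.g. when P and Q are probability measures
   with finite second moments; an infinite infimum would give the value 0. *)
definition wasserstein2 :: "'a::metric_space measure \<Rightarrow> 'a measure \<Rightarrow> real" where
  "wasserstein2 P Q =
     sqrt (enn2real (INF \<pi>\<in>couplings P Q. \<integral>\<^sup>+ p. ennreal ((dist (fst p) (snd p))\<^sup>2) \<partial>\<pi>))"

(* Densities are only determined almost everywhere, but a continuous density is unique if there
   is one, so that its logarithm has a well-defined pointwise gradient. *)
definition continuous_pdf :: "'a::euclidean_space measure \<Rightarrow> 'a \<Rightarrow> real" where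
  "continuous_pdf P =
     (SOME f. continuous_on UNIV f \<and> (\<forall>y. 0 \<le> f y) \<and> P = density lborel (\<lambda>y. ennreal (f y)))"

definition score :: "'a::euclidean_space measure \<Rightarrow> 'a \<Rightarrow> 'a" where
  "score P y = (THE g. GDERIV (\<lambda>x. ln (continuous_pdf P x)) y :> g)"

definition generator :: "(real^'d) \<times> (real^'d) \<Rightarrow> real^'d \<Rightarrow> real^'d" where
  "generator \<theta> z = outer (fst \<theta>) (snd \<theta>) *v z"

definition generator_law :: "(real^'d) \<times> (real^'d) \<Rightarrow> (real^'d) measure" where
  "generator_law \<theta> = distr std_gaussian borel (generator \<theta>)"

(* The law of A G(z) + s eps with z and eps independent standard normal vectors. *)
definition noisy_law ::
    "real^'d^'m \<Rightarrow> (real^'d) \<times> (real^'d) \<Rightarrow> real \<Rightarrow> (real^'m) measure" where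
  "noisy_law A \<theta> s =
     distr (std_gaussian \<Otimes>\<^sub>M std_gaussian) borel (\<lambda>(z, \<epsilon>). A *v generator \<theta> z + s *\<^sub>R \<epsilon>)"

definition teacher_score :: "real^'d^'m \<Rightarrow> real^'d \<Rightarrow> real \<Rightarrow> real^'m \<Rightarrow> real^'m" where
  "teacher_score A e \<tau> y =
     - (matrix_inv (A ** outer e e ** transpose A + \<tau> *\<^sub>R mat 1) *v y)"

(* The measure "lebesgue_on {0..1}" is the uniform distribution on [0,1]. The loss is
   extended-real valued, so both expectations make sense without integrability assumptions. *)
definition distillation_loss ::
    "real^'d^'m \<Rightarrow> real^'d \<Rightarrow> real \<Rightarrow> (real \<Rightarrow> real) \<Rightarrow> (real^'d) \<times> (real^'d) \<Rightarrow> ennreal" where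
  "distillation_loss A e \<sigma> \<sigma>t \<theta> =
     (\<integral>\<^sup>+ t. (\<integral>\<^sup>+ y. ennreal ((norm (teacher_score A e (\<sigma>\<^sup>2 + (\<sigma>t t)\<^sup>2) y
                                  - score (noisy_law A \<theta> (\<sigma>t t)) y))\<^sup>2)
              \<partial>noisy_law A \<theta> (\<sigma>t t)) \<partial>lebesgue_on {0..1})"

definition theta_of :: "real^'d \<Rightarrow> (real^'d) \<times> (real^'d)" where
  "theta_of u = (u, u /\<^sub>R norm u)"

definition Theta_star :: "real^'d^'m \<Rightarrow> real^'d \<Rightarrow> real \<Rightarrow> (real^'d) set" where
  "Theta_star A e \<sigma> =
     (let c = sqrt (1 + \<sigma>\<^sup>2 / (norm (A *v e))\<^sup>2)
      in {s + q | s q. s \<in> {c *\<^sub>R e, - (c *\<^sub>R e)} \<and> A *v q = 0})"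

end

theory Submission
  imports Defs
begin

text \<open>
  With \<open>v = u / \<parallel>u\<parallel>\<close> and \<open>b = Au\<close>, a noisy observation is \<open>y = (v \<bullet> z) b + s \<epsilon>\<close>, where \<open>v \<bullet> z\<close> is
  standard normal. Completing the square in this variable gives the density, hence the score, of
  \<open>y\<close>, and the expected squared score difference splits into a term independent of \<open>u\<close> plus
  two nonnegative terms. Writing \<open>a = Ae\<close> and \<open>\<tau> = \<sigma>\<^sup>2 + s\<^sup>2\<close>, one of them vanishes iff
  \<open>s\<^sup>2 + \<parallel>b\<parallel>\<^sup>2 = \<tau> + \<parallel>a\<parallel>\<^sup>2\<close> and the other, by the equality case of Cauchy--Schwarz, iff \<open>b\<close> is
  parallel to \<open>a\<close>. These conditions do not depend on the noise level \<open>s\<close>, so the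
  minimizers are the same for every \<open>t\<close>.

  If \<open>e\<close> is orthogonal to \<open>ker A\<close>, the minimum norm solutions are \<open>\<plusminus>c e\<close> with
  \<open>c = sqrt (1 + \<sigma>\<^sup>2 / \<parallel>a\<parallel>\<^sup>2)\<close>, and the laws to be compared are those of \<open>w e\<close> and \<open>w (c e)\<close> with \<open>w\<close> standard normal. Using the same \<open>w\<close> for both is an optimal coupling,
  because \<open>\<parallel>x - y\<parallel>\<^sup>2 + (c - 1) \<parallel>x\<parallel>\<^sup>2 \<ge> (1 - 1/c) \<parallel>y\<parallel>\<^sup>2\<close>, where integrating both sides leaves no slack.
\<close>

section \<open>Standard Gaussian vectors\<close>

lemma sets_std_gaussian [simp, measurable_cong]: "sets std_gaussian = sets borel"
  and space_std_gaussian [simp]: "space std_gaussian = UNIV"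
  by (simp_all add: std_gaussian_def)

lemma Basis_vec_real: "(Basis :: (real^'n) set) = range (\<lambda>i. axis i 1)"
  by (auto simp: Basis_vec_def)

lemma inj_axis_1: "inj (\<lambda>i. axis i (1::real) :: real^'n)"
  by (auto simp: inj_on_def axis_eq_axis)

text \<open>Tonelli in coordinates: the product rule for \<open>lborel\<close> runs over
  \<open>Basis\<close>, which is the injective image of the index type under \<open>axis\<close>, so
  it can be reindexed.\<close>

lemma nn_integral_lborel_vec_prod:
  fixes f :: "'n::finite \<Rightarrow> real \<Rightarrow> ennreal"
  assumes [measurable]: "\<And>i. f i \<in> borel_measurable borel"
  shows "(\<integral>\<^sup>+z. (\<Prod>i\<in>UNIV. f i (z $ i)) \<partial>lborel) = (\<Prod>i\<in>UNIV. \<integral>\<^sup>+x. f i x \<partial>lborel)"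
proof -
  let ?g = "\<lambda>b::real^'n. f (inv (\<lambda>i. axis i 1) b)"
  have inv: "inv (\<lambda>i. axis i (1::real) :: real^'n) (axis i 1) = i" for i
    by (rule inv_f_f[OF inj_axis_1])
  have "(\<integral>\<^sup>+z. (\<Prod>b\<in>Basis. ?g b (z \<bullet> b)) \<partial>lborel) = (\<Prod>b\<in>Basis. \<integral>\<^sup>+x. ?g b x \<partial>lborel)"
    by (rule nn_integral_lborel_prod) auto
  then show ?thesis
    by (simp add: Basis_vec_real prod.reindex[OF inj_axis_1] inv cart_eq_inner_axis[symmetric])
qed

text \<open>Both the density and the indicator of a box factor over the coordinates. Total mass,
  marginals and independence are all read off from this by choosing the box.\<close>

lemma emeasure_std_gaussian_box:
  fixes C :: "'n::finite \<Rightarrow> real set"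
  assumes [measurable]: "\<And>i. C i \<in> sets borel"
  shows "emeasure std_gaussian {z::real^'n. \<forall>i. z $ i \<in> C i}
    = (\<Prod>i\<in>UNIV. emeasure std_normal_distribution (C i))"
proof -
  have [measurable]: "{z::real^'n. \<forall>i. z $ i \<in> C i} \<in> sets borel"
    by measurable
  have ind: "indicator {z::real^'n. \<forall>i. z $ i \<in> C i} z = (\<Prod>i\<in>UNIV. indicator (C i) (z $ i) :: ennreal)"
    for z
    by (auto simp: indicator_def)
  have "emeasure std_gaussian {z::real^'n. \<forall>i. z $ i \<in> C i}
    = (\<integral>\<^sup>+z. (\<Prod>i\<in>UNIV. ennreal (std_normal_density (z $ i)) * indicator (C i) (z $ i)) \<partial>lborel)"
    unfolding std_gaussian_def
    by (subst emeasure_density) (auto simp: ind prod.distrib prod_ennreal)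
  also have "\<dots> = (\<Prod>i\<in>UNIV. \<integral>\<^sup>+x. ennreal (std_normal_density x) * indicator (C i) x \<partial>lborel)"
    by (rule nn_integral_lborel_vec_prod) measurable
  also have "\<dots> = (\<Prod>i\<in>UNIV. emeasure std_normal_distribution (C i))"
    by (intro prod.cong refl) (simp add: emeasure_density)
  finally show ?thesis .
qed

interpretation std_normal: prob_space std_normal_distribution
  by (rule real_dist_normal_dist[unfolded real_distribution_def, THEN conjunct1])

lemma emeasure_std_normal_UNIV [simp]: "emeasure std_normal_distribution UNIV = 1"
  using std_normal.emeasure_space_1 by simp

lemma prob_space_std_gaussian: "prob_space (std_gaussian :: (real^'n) measure)"
proof
  show "emeasure std_gaussian (space std_gaussian :: (real^'n) set) = 1"
    using emeasure_std_gaussian_box[of "\<lambda>_::'n. UNIV"] by simp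
qed

interpretation std_gaussian: prob_space "std_gaussian :: (real^'n) measure"
  by (rule prob_space_std_gaussian)

lemma emeasure_std_gaussian_UNIV [simp]: "emeasure (std_gaussian :: (real^'n) measure) UNIV = 1"
  using std_gaussian.emeasure_space_1[where 'n='n] by simp

lemma distr_std_gaussian_component: "distr std_gaussian borel (\<lambda>z::real^'n. z $ k) = std_normal_distribution"
proof (rule measure_eqI)
  fix X :: "real set" assume "X \<in> sets (distr std_gaussian borel (\<lambda>z::real^'n. z $ k))"
  then have [measurable]: "X \<in> sets borel" by simp
  have "emeasure (distr std_gaussian borel (\<lambda>z::real^'n. z $ k)) X
      = emeasure std_gaussian {z::real^'n. \<forall>i. z $ i \<in> (if i = k then X else UNIV)}"
    by (subst emeasure_distr) (auto intro!: arg_cong[where f="emeasure std_gaussian"] split: if_splits)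
  also have "\<dots> = (\<Prod>i\<in>UNIV. emeasure std_normal_distribution (if i = k then X else UNIV))"
    by (rule emeasure_std_gaussian_box) simp
  also have "\<dots> = (\<Prod>i\<in>UNIV. if i = k then emeasure std_normal_distribution X else 1)"
    by (rule prod.cong) simp_all
  finally show "emeasure (distr std_gaussian borel (\<lambda>z::real^'n. z $ k)) X
    = emeasure std_normal_distribution X" by simp
qed simp

lemma indep_vars_std_gaussian: "std_gaussian.indep_vars (\<lambda>_. borel) (\<lambda>i (z::real^'n). z $ i) UNIV"
  unfolding std_gaussian.indep_vars_def2
proof (intro conjI ballI std_gaussian.indep_setsI)
  fix A :: "'n \<Rightarrow> (real^'n) set" and J :: "'n set"
  assume "\<forall>j\<in>J. A j \<in> {(\<lambda>z. z $ j) -` B \<inter> space std_gaussian |B. B \<in> sets borel}"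
  then obtain B where B: "\<And>j. j \<in> J \<Longrightarrow> A j = (\<lambda>z. z $ j) -` B j" "\<And>j. j \<in> J \<Longrightarrow> B j \<in> sets borel"
    by (simp, metis)
  \<comment> \<open>Padding with \<open>UNIV\<close> turns the intersection over \<open>J\<close>
    into a full box; the padded factors have measure 1.\<close>
  define C where "C j = (if j \<in> J then B j else UNIV)" for j
  have [measurable]: "C j \<in> sets borel" for j using B(2) by (auto simp: C_def)
  have A: "emeasure std_gaussian (A j) = emeasure std_normal_distribution (C j)" if "j \<in> J" for j
    using that B by (subst distr_std_gaussian_component[of j, symmetric], subst emeasure_distr) (auto simp: C_def)
  have "(\<Inter>j\<in>J. A j) = {z. \<forall>i. z $ i \<in> C i}"
    using B(1) by (auto simp: C_def split: if_splits)
  then have "emeasure std_gaussian (\<Inter>j\<in>J. A j) = (\<Prod>i\<in>UNIV. emeasure std_normal_distribution (C i))"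
    using emeasure_std_gaussian_box[of C] by simp
  also have "\<dots> = (\<Prod>i\<in>J. emeasure std_normal_distribution (C i))"
    by (intro prod.mono_neutral_right) (auto simp: C_def)
  also have "\<dots> = (\<Prod>j\<in>J. emeasure std_gaussian (A j))" using A by simp
  finally show "std_gaussian.prob (\<Inter>j\<in>J. A j) = (\<Prod>j\<in>J. std_gaussian.prob (A j))"
    by (simp add: std_gaussian.emeasure_eq_measure prod_ennreal prod_nonneg)
qed (auto intro!: measurable_sets_borel)

text \<open>A sum of independent centred normals is normal and the variances add up; here they add
  up to |v|^2 = 1.\<close>

lemma distr_std_gaussian_inner:
  fixes v :: "real^'n"
  assumes v: "norm v = 1"
  shows "distr std_gaussian borel (\<lambda>z. v \<bullet> z) = std_normal_distribution"
proof -
  \<comment> \<open>Coordinates with \<open>v $ i = 0\<close> are dropped because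
    \<open>sum_indep_normal\<close> asks for positive standard deviations.\<close>
  define I where "I = {i. v $ i \<noteq> 0}"
  have ne: "I \<noteq> {}" using v by (auto simp: I_def) (metis norm_zero vec_eq_iff zero_index zero_neq_one)
  have dist: "distributed std_gaussian lborel (\<lambda>z::real^'n. z $ i) (normal_density 0 1)" for i
    using distr_cong[OF refl, of borel lborel "std_gaussian :: (real^'n) measure" "\<lambda>z. z $ i" "\<lambda>z. z $ i"]
    by (simp add: distributed_def distr_std_gaussian_component)
  have "distributed std_gaussian lborel (\<lambda>z. \<Sum>i\<in>I. v $ i * z $ i)
      (normal_density (\<Sum>i\<in>I. 0) (sqrt (\<Sum>i\<in>I. \<bar>v $ i\<bar>\<^sup>2)))"
  proof (rule std_gaussian.sum_indep_normal[OF _ ne])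
    show "std_gaussian.indep_vars (\<lambda>_. borel) (\<lambda>i z. v $ i * z $ i) I"
      by (rule std_gaussian.indep_vars_compose2[where M'="\<lambda>_. borel" and X="\<lambda>i z. z $ i"])
         (auto intro: std_gaussian.indep_vars_subset[OF indep_vars_std_gaussian])
    show "distributed std_gaussian lborel (\<lambda>z. v $ i * z $ i) (normal_density 0 \<bar>v $ i\<bar>)" if "i \<in> I" for i
      using std_gaussian.normal_density_affine[OF dist, where \<alpha>="v $ i" and \<beta>=0] that
      by (simp add: I_def mult.commute)
  qed (auto simp: I_def)
  moreover have "(\<Sum>i\<in>I. \<bar>v $ i\<bar>\<^sup>2) = (\<Sum>i\<in>UNIV. (v $ i)\<^sup>2)"
    by (simp, rule sum.mono_neutral_left) (auto simp: I_def)
  moreover have "(\<Sum>i\<in>UNIV. (v $ i)\<^sup>2) = 1"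
    using v by (simp add: norm_eq_1 inner_vec_def power2_eq_square)
  moreover have "(\<lambda>z. \<Sum>i\<in>I. v $ i * z $ i) = (\<lambda>z. v \<bullet> z)"
    by (auto simp: inner_vec_def fun_eq_iff I_def intro!: sum.mono_neutral_left)
  ultimately have D: "distributed std_gaussian lborel (\<lambda>z. v \<bullet> z) (normal_density 0 1)"
    by simp
  have "distr std_gaussian borel (\<lambda>z. v \<bullet> z) = distr std_gaussian lborel (\<lambda>z. v \<bullet> z)"
    by (rule distr_cong) auto
  with D show ?thesis by (simp add: distributed_def)
qed

section \<open>Second moments of Gaussian vectors\<close>

lemma nn_integral_std_normal_sq:
  "(\<integral>\<^sup>+w. ennreal ((c + r * w)\<^sup>2) \<partial>std_normal_distribution) = ennreal (c\<^sup>2 + r\<^sup>2)"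
proof -
  have 0: "has_bochner_integral lborel std_normal_density 1"
    using std_normal_moment_even[of 0] by simp
  have 1: "has_bochner_integral lborel (\<lambda>w. std_normal_density w * w) 0"
    using std_normal_moment_odd[of 0] by simp
  have 2: "has_bochner_integral lborel (\<lambda>w. std_normal_density w * w\<^sup>2) 1"
    using std_normal_moment_even[of 1] by simp
  have "has_bochner_integral lborel
      (\<lambda>w. c\<^sup>2 * std_normal_density w + 2 * c * r * (std_normal_density w * w) + r\<^sup>2 * (std_normal_density w * w\<^sup>2))
      (c\<^sup>2 * 1 + 2 * c * r * 0 + r\<^sup>2 * 1)"
    by (intro has_bochner_integral_add has_bochner_integral_mult_right 0 1 2)
  then have "has_bochner_integral lborel (\<lambda>w. std_normal_density w * (c + r * w)\<^sup>2) (c\<^sup>2 + r\<^sup>2)"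
    by (rule has_bochner_integral_cong[THEN iffD1, rotated -1]) (auto simp: power2_eq_square algebra_simps)
  then have "(\<integral>\<^sup>+w. ennreal (std_normal_density w * (c + r * w)\<^sup>2) \<partial>lborel) = ennreal (c\<^sup>2 + r\<^sup>2)"
    by (subst nn_integral_eq_integral) (auto simp: has_bochner_integral_iff)
  then show ?thesis
    by (simp add: nn_integral_density ennreal_mult)
qed

text \<open>Rescaling \<open>r\<close> to a unit vector reduces this to
  \<open>distr_std_gaussian_inner\<close>. For \<open>r = 0\<close> both integrands are the constant
  \<open>f 0\<close> and both measures have mass 1.\<close>

lemma nn_integral_std_gaussian_inner_norm:
  fixes r :: "real^'n"
  assumes [measurable]: "f \<in> borel_measurable borel"
  shows "(\<integral>\<^sup>+z. f (r \<bullet> z) \<partial>std_gaussian) = (\<integral>\<^sup>+w. f (norm r * w) \<partial>std_normal_distribution)"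
proof (cases "r = 0")
  case True
  then show ?thesis
    by simp
next
  case False
  then have v: "norm (r /\<^sub>R norm r) = 1" by simp
  show ?thesis
    using False by (simp add: distr_std_gaussian_inner[OF v, symmetric] nn_integral_distr del: inner_scaleR_left)
        (simp add: mult.assoc[symmetric])
qed

lemma nn_integral_std_gaussian_affine_sq:
  fixes r :: "real^'n"
  shows "(\<integral>\<^sup>+z. ennreal ((c + r \<bullet> z)\<^sup>2) \<partial>std_gaussian) = ennreal (c\<^sup>2 + (norm r)\<^sup>2)"
  using nn_integral_std_gaussian_inner_norm[of "\<lambda>x. ennreal ((c + x)\<^sup>2)" r]
  by (simp add: nn_integral_std_normal_sq)

lemma matrix_vector_mult_component_inner:
  fixes M :: "real^'n^'k" shows "(M *v x) $ i = row i M \<bullet> x"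
  by (simp add: matrix_vector_mul_component row_def inner_vec_def matrix_vector_mult_def)

text \<open>For y = (v . z) b + s eps, with covariance S = bb^T + s^2 I, this is E |My|^2 = tr (M S
  M^T), computed row by row. The sum over the rows is the squared Frobenius norm of
  \<open>M\<close>.\<close>

lemma nn_integral_gaussian_quadratic:
  fixes M :: "real^'m^'k" and b :: "real^'m" and v :: "real^'d"
  assumes v: "norm v = 1"
  shows "(\<integral>\<^sup>+x. ennreal ((norm (M *v ((v \<bullet> fst x) *\<^sub>R b + s *\<^sub>R snd x)))\<^sup>2)
        \<partial>(std_gaussian \<Otimes>\<^sub>M std_gaussian))
    = ennreal ((norm (M *v b))\<^sup>2 + s\<^sup>2 * (\<Sum>i\<in>UNIV. (norm (row i M))\<^sup>2))"
proof -
  have sq: "(\<integral>\<^sup>+x. ennreal (((v \<bullet> fst x) * p + s * (r \<bullet> snd x))\<^sup>2) \<partial>(std_gaussian \<Otimes>\<^sub>M std_gaussian))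
    = ennreal (p\<^sup>2 + s\<^sup>2 * (norm r)\<^sup>2)" for p and r :: "real^'m"
  proof -
    have "(\<integral>\<^sup>+x. ennreal (((v \<bullet> fst x) * p + s * (r \<bullet> snd x))\<^sup>2) \<partial>(std_gaussian \<Otimes>\<^sub>M std_gaussian))
      = (\<integral>\<^sup>+z. (\<integral>\<^sup>+y. ennreal (((v \<bullet> z) * p + (s *\<^sub>R r) \<bullet> y)\<^sup>2) \<partial>std_gaussian) \<partial>std_gaussian)"
      by (subst std_gaussian.nn_integral_fst[symmetric]) simp_all
    \<comment> \<open>Integrating out the noise first, with (v . z) p as a constant shift, leaves an
      integral over \<open>z\<close> alone.\<close>
    also have "\<dots> = (\<integral>\<^sup>+z. ennreal ((0 + (p *\<^sub>R v) \<bullet> z)\<^sup>2) + ennreal (s\<^sup>2 * (norm r)\<^sup>2) \<partial>std_gaussian)"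
      by (subst nn_integral_std_gaussian_affine_sq)
         (simp add: power_mult_distrib ennreal_plus[symmetric] mult.commute del: ennreal_plus)
    also have "\<dots> = ennreal (p\<^sup>2) + ennreal (s\<^sup>2 * (norm r)\<^sup>2)"
      using v
      by (subst nn_integral_add) (simp_all only: nn_integral_std_gaussian_affine_sq, simp_all)
    finally show ?thesis by simp
  qed
  have "(norm (M *v ((v \<bullet> fst x) *\<^sub>R b + s *\<^sub>R snd x)))\<^sup>2
    = (\<Sum>i\<in>UNIV. ((v \<bullet> fst x) * (row i M \<bullet> b) + s * (row i M \<bullet> snd x))\<^sup>2)" for x :: "(real^'d) \<times> (real^'m)"
    by (simp only: power2_norm_eq_inner inner_vec_def[of "M *v y" for y] matrix_vector_mult_component_inner inner_real_def)
       (simp add: inner_add_right power2_eq_square)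
  then have "(\<integral>\<^sup>+x. ennreal ((norm (M *v ((v \<bullet> fst x) *\<^sub>R b + s *\<^sub>R snd x)))\<^sup>2)
        \<partial>(std_gaussian \<Otimes>\<^sub>M std_gaussian))
    = (\<integral>\<^sup>+x. (\<Sum>i\<in>UNIV. ennreal (((v \<bullet> fst x) * (row i M \<bullet> b) + s * (row i M \<bullet> snd x))\<^sup>2))
        \<partial>(std_gaussian \<Otimes>\<^sub>M std_gaussian))"
    by (simp add: sum_ennreal)
  also have "\<dots> = (\<Sum>i\<in>UNIV. ennreal ((row i M \<bullet> b)\<^sup>2 + s\<^sup>2 * (norm (row i M))\<^sup>2))"
    by (subst nn_integral_sum) (simp_all add: sq)
  also have "\<dots> = ennreal (\<Sum>i\<in>UNIV. (row i M \<bullet> b)\<^sup>2 + s\<^sup>2 * (norm (row i M))\<^sup>2)"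
    by (subst sum_ennreal) auto
  also have "(\<Sum>i\<in>UNIV. (row i M \<bullet> b)\<^sup>2 + s\<^sup>2 * (norm (row i M))\<^sup>2)
    = (norm (M *v b))\<^sup>2 + s\<^sup>2 * (\<Sum>i\<in>UNIV. (norm (row i M))\<^sup>2)"
    by (simp only: power2_norm_eq_inner[of "M *v b"] inner_vec_def[of "M *v b"]
        matrix_vector_mult_component_inner inner_real_def)
       (simp add: sum.distrib sum_distrib_left power2_eq_square)
  finally show ?thesis .
qed

section \<open>Density of a scaled and shifted standard Gaussian\<close>

lemma std_gaussian_density_eq:
  "(\<Prod>i\<in>UNIV. std_normal_density (z $ i)) = (1 / sqrt (2 * pi)) ^ CARD('n) * exp (- (norm z)\<^sup>2 / 2)"
  for z :: "real^'n"
proof -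
  have "(\<Prod>i\<in>UNIV. std_normal_density (z $ i))
    = (1 / sqrt (2 * pi)) ^ CARD('n) * (\<Prod>i\<in>UNIV. exp (- (z $ i)\<^sup>2 / 2))"
    by (simp only: std_normal_density_def prod.distrib prod_constant)
  also have "(\<Prod>i\<in>UNIV. exp (- (z $ i)\<^sup>2 / 2)) = exp (\<Sum>i\<in>UNIV. - (z $ i)\<^sup>2 / 2)"
    by (simp add: exp_sum)
  also have "(\<Sum>i\<in>UNIV. - (z $ i)\<^sup>2 / 2) = - (norm z)\<^sup>2 / 2"
    by (simp only: power2_norm_eq_inner inner_vec_def inner_real_def sum_negf
        sum_divide_distrib[symmetric]) (simp add: power2_eq_square sum_negf)
  finally show ?thesis .
qed

text \<open>The kernel on the right is the density of N(c, s^2 I). The substitution y = c + s z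
  contributes the Jacobian s^n, which cancels the factor s^(-n).\<close>

lemma nn_integral_std_gaussian_translate:
  fixes c :: "real^'n"
  assumes s: "s > 0" and [measurable]: "f \<in> borel_measurable borel"
  shows "(\<integral>\<^sup>+z. f (c + s *\<^sub>R z) \<partial>std_gaussian)
    = (\<integral>\<^sup>+y. f y * ennreal ((1 / (s * sqrt (2 * pi))) ^ CARD('n) * exp (- (norm (y - c))\<^sup>2 / (2 * s\<^sup>2))) \<partial>lborel)"
proof -
  let ?g = "\<lambda>y::real^'n. ennreal ((1 / (s * sqrt (2 * pi))) ^ CARD('n) * exp (- (norm (y - c))\<^sup>2 / (2 * s\<^sup>2)))"
  have dens: "ennreal (s ^ CARD('n)) * ?g (c + s *\<^sub>R z)
      = ennreal (\<Prod>i\<in>UNIV. std_normal_density (z $ i))" for z :: "real^'n"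
    using s by (simp add: ennreal_mult[symmetric] std_gaussian_density_eq power_mult_distrib power_divide)
  have "(\<integral>\<^sup>+y. f y * ?g y \<partial>lborel)
    = (\<integral>\<^sup>+y. f y * ?g y \<partial>density (distr lborel borel (\<lambda>x. c + s *\<^sub>R x)) (\<lambda>_. \<bar>s\<bar>^DIM(real^'n)))"
    using s by (subst lborel_affine[of s c]) auto
  also have "\<dots> = (\<integral>\<^sup>+z. f (c + s *\<^sub>R z) * (ennreal (s ^ CARD('n)) * ?g (c + s *\<^sub>R z)) \<partial>lborel)"
    using s by (subst nn_integral_density) (simp_all add: nn_integral_distr ac_simps ennreal_power)
  also have "\<dots> = (\<integral>\<^sup>+z. f (c + s *\<^sub>R z) \<partial>std_gaussian)"
    unfolding dens by (simp add: std_gaussian_def nn_integral_density mult.commute)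
  finally show ?thesis by simp
qed

section \<open>Density and score of a Gaussian with rank-one signal\<close>

text \<open>Bayes' rule for densities, up to a constant: the prior of \<open>w\<close> times the
  likelihood of \<open>y\<close> is the marginal of \<open>y\<close> times the posterior of
  \<open>w\<close>. With k = s^2 + |b|^2 the posterior is normal with mean (b . y) / k and standard
  deviation s / sqrt k.\<close>

lemma complete_square_std_normal:
  fixes b y :: "real^'n"
  assumes s: "s > 0"
  shows "std_normal_density w * exp (- (norm (y - w *\<^sub>R b))\<^sup>2 / (2 * s\<^sup>2))
    = s / sqrt (s\<^sup>2 + (norm b)\<^sup>2)
      * exp (- ((norm y)\<^sup>2 / s\<^sup>2 - (b \<bullet> y)\<^sup>2 / (s\<^sup>2 * (s\<^sup>2 + (norm b)\<^sup>2))) / 2)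
      * normal_density ((b \<bullet> y) / (s\<^sup>2 + (norm b)\<^sup>2)) (s / sqrt (s\<^sup>2 + (norm b)\<^sup>2)) w"
proof -
  define B k where "B = (norm b)\<^sup>2" and "k = s\<^sup>2 + B"
  have k: "k > 0" using s by (auto simp: k_def B_def intro!: add_pos_nonneg)
  have nrm: "(norm (y - w *\<^sub>R b))\<^sup>2 = (norm y)\<^sup>2 - 2 * w * (b \<bullet> y) + w\<^sup>2 * (k - s\<^sup>2)"
    unfolding k_def B_def power2_norm_eq_inner
    by (simp add: inner_diff_left inner_diff_right inner_commute power2_eq_square algebra_simps)
  have expo: "- w\<^sup>2 / 2 + - (norm (y - w *\<^sub>R b))\<^sup>2 / (2 * s\<^sup>2)
    = - ((norm y)\<^sup>2 / s\<^sup>2 - (b \<bullet> y)\<^sup>2 / (s\<^sup>2 * k)) / 2 + - (w - (b \<bullet> y) / k)\<^sup>2 / (2 * (s / sqrt k)\<^sup>2)"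
    unfolding nrm using s k by (simp add: field_simps power2_eq_square)
  have cst: "1 / sqrt (2 * pi) = s / sqrt k * (1 / sqrt (2 * pi * (s / sqrt k)\<^sup>2))"
    using s k by (simp add: real_sqrt_mult real_sqrt_divide)
  have "std_normal_density w * exp (- (norm (y - w *\<^sub>R b))\<^sup>2 / (2 * s\<^sup>2))
    = 1 / sqrt (2 * pi) * exp (- w\<^sup>2 / 2 + - (norm (y - w *\<^sub>R b))\<^sup>2 / (2 * s\<^sup>2))"
    by (simp only: std_normal_density_def exp_add mult.assoc)
  also have "\<dots> = s / sqrt k * exp (- ((norm y)\<^sup>2 / s\<^sup>2 - (b \<bullet> y)\<^sup>2 / (s\<^sup>2 * k)) / 2)
      * normal_density ((b \<bullet> y) / k) (s / sqrt k) w"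
    unfolding expo exp_add cst normal_density_def by (simp only: ac_simps)
  finally show ?thesis by (simp only: k_def B_def)
qed

text \<open>For \<open>s > 0\<close> this is the density of N(0, bb^T + s^2 I), with the determinant
  s^(2m-2) (s^2 + |b|^2) and the Sherman--Morrison inverse written out.\<close>

definition rank1_gaussian_pdf :: "real^'m \<Rightarrow> real \<Rightarrow> real^'m \<Rightarrow> real" where
  "rank1_gaussian_pdf b s y = (1 / (s * sqrt (2 * pi))) ^ CARD('m) * (s / sqrt (s\<^sup>2 + (norm b)\<^sup>2))
     * exp (- ((norm y)\<^sup>2 / s\<^sup>2 - (b \<bullet> y)\<^sup>2 / (s\<^sup>2 * (s\<^sup>2 + (norm b)\<^sup>2))) / 2)"

lemma rank1_gaussian_pdf_nonneg: "s > 0 \<Longrightarrow> 0 \<le> rank1_gaussian_pdf b s y"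
  by (simp add: rank1_gaussian_pdf_def)

lemma continuous_on_rank1_gaussian_pdf: "continuous_on S (rank1_gaussian_pdf b s)"
  unfolding rank1_gaussian_pdf_def [abs_def] divide_inverse by (intro continuous_intros)

lemma borel_measurable_rank1_gaussian_pdf [measurable]: "rank1_gaussian_pdf b s \<in> borel_measurable borel"
  by (rule borel_measurable_continuous_onI[OF continuous_on_rank1_gaussian_pdf])

text \<open>The posterior factor in \<open>complete_square_std_normal\<close> integrates to 1 over
  \<open>w\<close>, which leaves the marginal of \<open>y\<close>.\<close>

lemma nn_integral_rank1_mixture:
  fixes b y :: "real^'m"
  assumes s: "s > 0"
  shows "(\<integral>\<^sup>+w. ennreal ((1 / (s * sqrt (2 * pi))) ^ CARD('m) * exp (- (norm (y - w *\<^sub>R b))\<^sup>2 / (2 * s\<^sup>2)))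
      \<partial>std_normal_distribution) = ennreal (rank1_gaussian_pdf b s y)"
proof -
  let ?\<mu> = "(b \<bullet> y) / (s\<^sup>2 + (norm b)\<^sup>2)" and ?\<sigma> = "s / sqrt (s\<^sup>2 + (norm b)\<^sup>2)"
  have \<sigma>: "?\<sigma> > 0" using s by (auto intro!: divide_pos_pos real_sqrt_gt_zero add_pos_nonneg)
  have "(\<integral>\<^sup>+w. ennreal (normal_density ?\<mu> ?\<sigma> w) \<partial>lborel) = 1"
    using prob_space.emeasure_space_1[OF prob_space_normal_density[OF \<sigma>, of ?\<mu>]]
    by (simp add: emeasure_density)
  then have "(\<integral>\<^sup>+w. ennreal (rank1_gaussian_pdf b s y) * ennreal (normal_density ?\<mu> ?\<sigma> w) \<partial>lborel)
      = ennreal (rank1_gaussian_pdf b s y)"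
    by (subst nn_integral_cmult) auto
  moreover have "ennreal (std_normal_density w) * ennreal ((1 / (s * sqrt (2 * pi))) ^ CARD('m)
        * exp (- (norm (y - w *\<^sub>R b))\<^sup>2 / (2 * s\<^sup>2)))
      = ennreal (rank1_gaussian_pdf b s y) * ennreal (normal_density ?\<mu> ?\<sigma> w)" for w
  proof -
    have "std_normal_density w * ((1 / (s * sqrt (2 * pi))) ^ CARD('m)
        * exp (- (norm (y - w *\<^sub>R b))\<^sup>2 / (2 * s\<^sup>2)))
      = (1 / (s * sqrt (2 * pi))) ^ CARD('m)
        * (std_normal_density w * exp (- (norm (y - w *\<^sub>R b))\<^sup>2 / (2 * s\<^sup>2)))"
      by (simp only: ac_simps)
    also have "\<dots> = rank1_gaussian_pdf b s y * normal_density ?\<mu> ?\<sigma> w"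
      unfolding complete_square_std_normal[OF s] rank1_gaussian_pdf_def by (simp only: ac_simps)
    finally show ?thesis
      using s by (simp add: ennreal_mult[symmetric] rank1_gaussian_pdf_nonneg del: ennreal_mult)
  qed
  ultimately show ?thesis
    by (subst nn_integral_density) simp_all
qed

text \<open>Given \<open>z\<close>, the vector is Gaussian with mean (v . z) b. After the integrals
  are exchanged, \<open>z\<close> enters only through v . z, which is standard normal, so
  \<open>nn_integral_rank1_mixture\<close> applies.\<close>

lemma distr_rank1_signal_plus_noise:
  fixes b :: "real^'m" and v :: "real^'d"
  assumes s: "s > 0" and v: "norm v = 1"
  shows "distr (std_gaussian \<Otimes>\<^sub>M std_gaussian) borel (\<lambda>x. (v \<bullet> fst x) *\<^sub>R b + s *\<^sub>R snd x)
    = density lborel (\<lambda>y. ennreal (rank1_gaussian_pdf b s y))" (is "?D = _")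
proof (rule measure_eqI)
  fix X assume "X \<in> sets ?D"
  then have X [measurable]: "X \<in> sets borel" by simp
  define p where "p w y = ennreal ((1 / (s * sqrt (2 * pi))) ^ CARD('m) * exp (- (norm (y - w *\<^sub>R b))\<^sup>2 / (2 * s\<^sup>2)))"
    for w and y :: "real^'m"
  have p [measurable]: "(\<lambda>x. p (f x) (g x)) \<in> borel_measurable M"
    if [measurable]: "f \<in> borel_measurable M" "g \<in> borel_measurable M" for f g and M :: "'x measure"
    unfolding p_def by measurable
  interpret pair_sigma_finite "std_gaussian :: (real^'d) measure" "lborel :: (real^'m) measure" ..
  have "emeasure ?D X = (\<integral>\<^sup>+x. indicator X ((v \<bullet> fst x) *\<^sub>R b + s *\<^sub>R snd x) \<partial>(std_gaussian \<Otimes>\<^sub>M std_gaussian))"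
    using nn_integral_distr[of "\<lambda>x. (v \<bullet> fst x) *\<^sub>R b + s *\<^sub>R snd x" "std_gaussian \<Otimes>\<^sub>M std_gaussian"
        borel "indicator X :: _ \<Rightarrow> ennreal"] by simp
  also have "\<dots> = (\<integral>\<^sup>+z. (\<integral>\<^sup>+\<epsilon>. indicator X ((v \<bullet> z) *\<^sub>R b + s *\<^sub>R \<epsilon>) \<partial>std_gaussian) \<partial>std_gaussian)"
    by (subst std_gaussian.nn_integral_fst[symmetric]) simp_all
  also have "\<dots> = (\<integral>\<^sup>+z. (\<integral>\<^sup>+y. indicator X y * p (v \<bullet> z) y \<partial>lborel) \<partial>std_gaussian)"
    unfolding p_def by (subst nn_integral_std_gaussian_translate[OF s]) simp_all
  also have "\<dots> = (\<integral>\<^sup>+y. (\<integral>\<^sup>+z. indicator X y * p (v \<bullet> z) y \<partial>std_gaussian) \<partial>lborel)"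
    by (rule Fubini'[symmetric]) simp
  also have "\<dots> = (\<integral>\<^sup>+y. indicator X y * (\<integral>\<^sup>+w. p w y \<partial>std_normal_distribution) \<partial>lborel)"
    by (simp add: nn_integral_cmult nn_integral_std_gaussian_inner_norm[of "\<lambda>w. p w y" v for y] v)
  also have "\<dots> = emeasure (density lborel (\<lambda>y. ennreal (rank1_gaussian_pdf b s y))) X"
    unfolding p_def nn_integral_rank1_mixture[OF s] by (simp add: emeasure_density mult.commute)
  finally show "emeasure ?D X = \<dots>" .
qed simp

text \<open>Two densities of one measure agree almost everywhere. For continuous ones the set of
  agreement is closed, and a closed set of full Lebesgue measure is the whole space, so the choice
  in \<open>continuous_pdf\<close> is forced.\<close>

lemma continuous_pdf_eqI:
  fixes P :: "'a::euclidean_space measure"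
  assumes "continuous_on UNIV f" "\<And>y. 0 \<le> f y" "P = density lborel (\<lambda>y. ennreal (f y))"
  shows "continuous_pdf P = f"
  unfolding continuous_pdf_def
proof (rule some_equality)
  fix g assume g: "continuous_on UNIV g \<and> (\<forall>y. 0 \<le> g y) \<and> P = density lborel (\<lambda>y. ennreal (g y))"
  have [measurable]: "f \<in> borel_measurable borel" "g \<in> borel_measurable borel"
    using assms g by (auto intro: borel_measurable_continuous_onI)
  have "AE y in lborel. ennreal (f y) = ennreal (g y)"
    using g assms(3) by (subst sigma_finite_measure.density_unique_iff[OF sigma_finite_lborel, symmetric]) auto
  then have "AE y in lborel. f y = g y"
    using g assms(2) by simp
  moreover have "closed {y. f y = g y}"
    using closed_Collect_eq[OF assms(1)] g by blast
  ultimately have "y \<in> {y. f y = g y}" for y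
    using mem_closed_if_AE_lebesgue_open[of UNIV "{y. f y = g y}" y] 
    by (auto simp: AE_completion_iff)
  then show "g = f" by auto
qed (use assms in auto)

text \<open>The log density is a constant plus a quadratic form, so its gradient is linear: minus
  the inverse covariance applied to \<open>y\<close>.\<close>

lemma score_rank1_gaussian:
  fixes b y :: "real^'m"
  assumes s: "s > 0" and P: "P = density lborel (\<lambda>y. ennreal (rank1_gaussian_pdf b s y))"
  shows "score P y = - ((1 / s\<^sup>2) *\<^sub>R y - ((b \<bullet> y) / (s\<^sup>2 * (s\<^sup>2 + (norm b)\<^sup>2))) *\<^sub>R b)"
proof -
  define C where "C = (1 / (s * sqrt (2 * pi))) ^ CARD('m) * (s / sqrt (s\<^sup>2 + (norm b)\<^sup>2))"
  have C: "C > 0"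
    unfolding C_def using s by (auto intro!: mult_pos_pos divide_pos_pos real_sqrt_gt_zero add_pos_nonneg)
  have pdf: "continuous_pdf P x = C * exp (- (x \<bullet> x / s\<^sup>2 - (b \<bullet> x)\<^sup>2 / (s\<^sup>2 * (s\<^sup>2 + (norm b)\<^sup>2))) / 2)" for x
    unfolding continuous_pdf_eqI[OF continuous_on_rank1_gaussian_pdf rank1_gaussian_pdf_nonneg[OF s] P]
    by (simp only: rank1_gaussian_pdf_def C_def dot_square_norm)
  have ln: "(\<lambda>x. ln (continuous_pdf P x))
    = (\<lambda>x. ln C + (- (1 / (2 * s\<^sup>2)) * (x \<bullet> x)
        + 1 / (2 * (s\<^sup>2 * (s\<^sup>2 + (norm b)\<^sup>2))) * ((b \<bullet> x) * (b \<bullet> x))))"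
    unfolding pdf using C by (simp add: ln_mult power2_eq_square diff_divide_distrib mult.commute)
  \<comment> \<open>The left side follows the product rule for x . x and (b . x) (b . x); the right
    side is the inner product with a gradient that \<open>gderiv_def\<close> requires.\<close>
  have lin: "- (1 / (2 * p)) * (y \<bullet> h + h \<bullet> y) + 1 / (2 * q) * ((b \<bullet> y) * (b \<bullet> h) + (b \<bullet> h) * (b \<bullet> y))
      = h \<bullet> - ((1 / p) *\<^sub>R y - ((b \<bullet> y) / q) *\<^sub>R b)" for p q :: real and h
    by (simp add: inner_diff_right inner_commute)
  have G: "GDERIV (\<lambda>x. ln (continuous_pdf P x)) y :> - ((1 / s\<^sup>2) *\<^sub>R y - ((b \<bullet> y) / (s\<^sup>2 * (s\<^sup>2 + (norm b)\<^sup>2))) *\<^sub>R b)"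
    unfolding ln gderiv_def lin[symmetric]
    by (rule has_derivative_eq_rhs, (rule derivative_intros)+) (simp add: fun_eq_iff)
  show ?thesis
    unfolding score_def
  proof (rule the_equality[where P="\<lambda>g. GDERIV (\<lambda>x. ln (continuous_pdf P x)) y :> g", OF G])
    fix g assume "GDERIV (\<lambda>x. ln (continuous_pdf P x)) y :> g"
    from has_derivative_unique[OF this[unfolded gderiv_def] G[unfolded gderiv_def]]
    have "h \<bullet> g = h \<bullet> - ((1 / s\<^sup>2) *\<^sub>R y - ((b \<bullet> y) / (s\<^sup>2 * (s\<^sup>2 + (norm b)\<^sup>2))) *\<^sub>R b)" for h
      by (rule fun_cong)
    then show "g = - ((1 / s\<^sup>2) *\<^sub>R y - ((b \<bullet> y) / (s\<^sup>2 * (s\<^sup>2 + (norm b)\<^sup>2))) *\<^sub>R b)"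
      by (subst vector_eq_ldot[symmetric]) blast
  qed
qed

section \<open>The expected squared score difference\<close>

lemma outer_mult_vec: "outer u v *v x = (v \<bullet> x) *\<^sub>R u" for u :: "real^'n" and v x :: "real^'k"
  by (simp add: vec_eq_iff outer_def matrix_vector_mult_def inner_vec_def sum_distrib_left mult_ac)

lemma matrix_outer_conjugate: "A ** outer e e ** transpose A = outer (A *v e) (A *v e)"
  for A :: "real^'d^'m"
  by (simp add: matrix_eq matrix_vector_mul_assoc[symmetric] outer_mult_vec matrix_vector_mult_scaleR
      inner_commute dot_lmul_matrix[symmetric])

text \<open>A right inverse of a square matrix is two-sided, and a two-sided inverse is unique,
  which settles the choice in \<open>matrix_inv\<close>.\<close>

lemma matrix_inv_eqI:
  fixes M N :: "real^'n^'n"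
  assumes "M ** N = mat 1"
  shows "matrix_inv M = N"
proof -
  have "N ** M = mat 1" using assms matrix_left_right_inverse by blast
  then show ?thesis
    unfolding matrix_inv_def using assms
    by (intro some_equality) (auto, metis matrix_mul_assoc matrix_mul_lid matrix_mul_rid)
qed

text \<open>The Sherman--Morrison formula for the inverse of bb^T + t I.\<close>

definition rank1_inv :: "real \<Rightarrow> real^'n \<Rightarrow> real^'n^'n" where
  "rank1_inv t b = (1 / t) *\<^sub>R mat 1 - (1 / (t * (t + (norm b)\<^sup>2))) *\<^sub>R outer b b"

lemma rank1_inv_mult_vec:
  "rank1_inv t b *v y = (1 / t) *\<^sub>R y - ((b \<bullet> y) / (t * (t + (norm b)\<^sup>2))) *\<^sub>R b"
  by (simp add: rank1_inv_def matrix_vector_mult_diff_rdistrib scaleR_matrix_vector_assoc[symmetric] outer_mult_vec)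

lemma matrix_inv_rank1_update:
  fixes b :: "real^'n"
  assumes t: "t > 0"
  shows "matrix_inv (outer b b + t *\<^sub>R mat 1) = rank1_inv t b"
proof (rule matrix_inv_eqI, unfold matrix_eq, rule allI)
  fix x :: "real^'n"
  define k where "k = t + (norm b)\<^sup>2"
  have k: "k > 0" "b \<bullet> b = k - t"
    using t by (auto simp: k_def power2_norm_eq_inner intro!: add_pos_nonneg)
  \<comment> \<open>The vector \<open>b\<close> belongs to the eigenvalue \<open>k\<close> of bb^T +
    t I, so pairing the candidate inverse with \<open>b\<close> must divide by
    \<open>k\<close>.\<close>
  have "(b \<bullet> x) / t - (b \<bullet> x) / (t * k) * (k - t) = (b \<bullet> x) / k"
    using t k(1) by (simp add: field_simps)
  then have "(b \<bullet> (rank1_inv t b *v x)) = (b \<bullet> x) / k"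
    by (simp add: rank1_inv_mult_vec inner_diff_right k k_def[symmetric])
  then have "(outer b b + t *\<^sub>R mat 1) *v (rank1_inv t b *v x)
      = ((b \<bullet> x) / k) *\<^sub>R b + t *\<^sub>R (rank1_inv t b *v x)"
    by (simp only: matrix_vector_mult_add_rdistrib outer_mult_vec scaleR_matrix_vector_assoc[symmetric]
        matrix_vector_mul_lid)
  also have "\<dots> = x"
    using t k(1) by (simp add: rank1_inv_mult_vec k_def[symmetric] scaleR_diff_right)
  finally show "((outer b b + t *\<^sub>R mat 1) ** rank1_inv t b) *v x = mat 1 *v x"
    by (simp add: matrix_vector_mul_assoc[symmetric])
qed

section \<open>Both scores as linear maps\<close>

lemma teacher_score_eq:
  "\<tau> > 0 \<Longrightarrow> teacher_score A e \<tau> y = - (rank1_inv \<tau> (A *v e) *v y)"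
  by (simp add: teacher_score_def matrix_outer_conjugate matrix_inv_rank1_update)

lemma A_generator: "A *v generator (u, v) z = (v \<bullet> z) *\<^sub>R (A *v u)"
  for A :: "real^'d^'m"
  by (simp add: generator_def outer_mult_vec matrix_vector_mult_scaleR)

lemma noisy_law_eq_distr:
  "noisy_law A (u, v) s
    = distr (std_gaussian \<Otimes>\<^sub>M std_gaussian) borel (\<lambda>x. (v \<bullet> fst x) *\<^sub>R (A *v u) + s *\<^sub>R snd x)"
  by (simp add: noisy_law_def A_generator case_prod_unfold)

lemma score_noisy_law:
  assumes "s > 0" "norm v = 1"
  shows "score (noisy_law A (u, v) s) y = - (rank1_inv (s\<^sup>2) (A *v u) *v y)"
  unfolding rank1_inv_mult_vec
  by (rule score_rank1_gaussian[OF assms(1)])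
     (simp add: noisy_law_eq_distr distr_rank1_signal_plus_noise[OF assms])

text \<open>The Fisher divergence between the Gaussians with covariances \<open>bb\<^sup>T + s\<^sup>2 I\<close> and
  \<open>aa\<^sup>T + \<tau> I\<close>, as a sum of three nonnegative terms of which the first does not depend on \<open>b\<close>.\<close>
definition fisher :: "real^'m \<Rightarrow> real \<Rightarrow> real \<Rightarrow> real^'m \<Rightarrow> real" where
  "fisher a \<tau> s b =
     (real CARD('m) - 1) * s\<^sup>2 * (1 / s\<^sup>2 - 1 / \<tau>)\<^sup>2
     + (s\<^sup>2 + (norm b)\<^sup>2) * (1 / (s\<^sup>2 + (norm b)\<^sup>2) - 1 / (\<tau> + (norm a)\<^sup>2))\<^sup>2
     + ((norm b)\<^sup>2 - (a \<bullet> b)\<^sup>2 / (norm a)\<^sup>2) * (1 / \<tau>\<^sup>2 - 1 / (\<tau> + (norm a)\<^sup>2)\<^sup>2)"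

lemma row_add: "row i (M + N) = row i M + row i N"
  and row_diff: "row i (M - N) = row i M - row i N"
  and row_scaleR: "row i (c *\<^sub>R M) = c *\<^sub>R row i M"
  for M N :: "real^'n^'k"
  by (simp_all add: row_def vec_eq_iff)

lemma row_mat_1: "row i (mat 1 :: real^'n^'n) = axis i 1"
  by (simp add: row_def vec_eq_iff mat_def axis_def)

lemma row_outer: "row i (outer u v) = (u $ i) *\<^sub>R v"
  by (simp add: row_def vec_eq_iff outer_def)

text \<open>The scalar form of \<open>fisher_eq\<close>, with t = s^2, T = \<tau>, A = |a|^2, B =
  |b|^2, q = (a . b)^2 and \<open>m\<close> the dimension. The left side is the expansion for the
  matrix \<alpha> I - \<gamma> bb^T + \<beta> aa^T.\<close>

lemma rank1_gaussian_gap_identity: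
  fixes T t A B q m :: real
  assumes "t > 0" "T > 0" "A > 0" "B \<ge> 0" 
  defines "\<alpha> \<equiv> 1 / t - 1 / T" and "\<gamma> \<equiv> 1 / (t * (t + B))" and "\<beta> \<equiv> 1 / (T * (T + A))"
  shows "(\<alpha> - \<gamma> * B)\<^sup>2 * B + 2 * (\<alpha> - \<gamma> * B) * \<beta> * q + \<beta>\<^sup>2 * q * A
     + t * (m * \<alpha>\<^sup>2 + \<gamma>\<^sup>2 * B\<^sup>2 + \<beta>\<^sup>2 * A\<^sup>2 - 2 * \<alpha> * \<gamma> * B + 2 * \<alpha> * \<beta> * A - 2 * \<gamma> * \<beta> * q)
   = (m - 1) * t * (1 / t - 1 / T)\<^sup>2 + (t + B) * (1 / (t + B) - 1 / (T + A))\<^sup>2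
     + (B - q / A) * (1 / T\<^sup>2 - 1 / (T + A)\<^sup>2)"
proof -
  \<comment> \<open>Naming the two sums keeps the denominators simple, so that clearing them leaves
    a polynomial identity.\<close>
  define x y where "x = t + B" and "y = T + A"
  have B: "B = x - t" and A: "A = y - T" by (auto simp: x_def y_def)
  have pos: "x > 0" "y > 0" "y - T > 0" using assms by (auto simp: x_def y_def)
  show ?thesis
    unfolding \<alpha>_def \<beta>_def \<gamma>_def x_def[symmetric] y_def[symmetric] unfolding A B
    using pos assms(1,2) by (simp add: divide_simps power2_eq_square) (simp only: algebra_simps)
qed

text \<open>The left side is the expected squared norm of Dy for y of covariance bb^T + s^2 I, as in
  \<open>nn_integral_gaussian_quadratic\<close>. As \<open>D\<close> is a combination of I, bb^T and
  aa^T, only |a|, |b|, a . b and the dimension survive.\<close>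

lemma fisher_eq:
  fixes a b :: "real^'m"
  assumes s: "s > 0" and \<tau>: "\<tau> > 0" and a: "a \<noteq> 0"
  defines "D \<equiv> rank1_inv (s\<^sup>2) b - rank1_inv \<tau> a"
  shows "(norm (D *v b))\<^sup>2 + s\<^sup>2 * (\<Sum>i\<in>UNIV. (norm (row i D))\<^sup>2) = fisher a \<tau> s b"
proof -
  define A B q where "A = (norm a)\<^sup>2" and "B = (norm b)\<^sup>2" and "q = (a \<bullet> b)\<^sup>2"
  define \<alpha> \<beta> \<gamma> where "\<alpha> = 1 / s\<^sup>2 - 1 / \<tau>" and "\<beta> = 1 / (\<tau> * (\<tau> + A))" and "\<gamma> = 1 / (s\<^sup>2 * (s\<^sup>2 + B))"
  have inner: "a \<bullet> a = A" "b \<bullet> b = B" "(a \<bullet> b) * (a \<bullet> b) = q" "b \<bullet> a = a \<bullet> b"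
    unfolding A_def B_def q_def power2_norm_eq_inner power2_eq_square[of "a \<bullet> b"]
    by (simp_all add: inner_commute)
  have D: "D = \<alpha> *\<^sub>R mat 1 - \<gamma> *\<^sub>R outer b b + \<beta> *\<^sub>R outer a a"
    by (simp add: D_def rank1_inv_def \<alpha>_def \<beta>_def \<gamma>_def A_def B_def scaleR_diff_left)
  have "D *v b = (\<alpha> - \<gamma> * B) *\<^sub>R b + (\<beta> * (a \<bullet> b)) *\<^sub>R a"
    by (simp only: D matrix_vector_mult_diff_rdistrib matrix_vector_mult_add_rdistrib outer_mult_vec
        scaleR_matrix_vector_assoc[symmetric] matrix_vector_mul_lid inner scaleR_diff_left scaleR_scaleR)
  then have Db: "(norm (D *v b))\<^sup>2 = (\<alpha> - \<gamma> * B)\<^sup>2 * B + 2 * (\<alpha> - \<gamma> * B) * \<beta> * q + \<beta>\<^sup>2 * q * A"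
    unfolding power2_norm_eq_inner
    by (simp add: inner_add_left inner_add_right inner)
       (simp add: power2_eq_square inner(3)[symmetric] algebra_simps)
  have "(norm (row i D))\<^sup>2 = \<alpha>\<^sup>2 + \<gamma>\<^sup>2 * B * (b $ i)\<^sup>2 + \<beta>\<^sup>2 * A * (a $ i)\<^sup>2
      - 2 * \<alpha> * \<gamma> * (b $ i)\<^sup>2 + 2 * \<alpha> * \<beta> * (a $ i)\<^sup>2 - 2 * \<gamma> * \<beta> * (a \<bullet> b) * (a $ i * b $ i)" for i
    unfolding power2_norm_eq_inner D row_add row_diff row_scaleR row_mat_1 row_outer
    by (simp add: inner_add_left inner_add_right inner_diff_left inner_diff_right inner inner_axis inner_axis')
       (simp add: power2_eq_square algebra_simps)
  then have "(\<Sum>i\<in>UNIV. (norm (row i D))\<^sup>2) = real CARD('m) * \<alpha>\<^sup>2 + \<gamma>\<^sup>2 * B * (\<Sum>i\<in>UNIV. (b $ i)\<^sup>2)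
      + \<beta>\<^sup>2 * A * (\<Sum>i\<in>UNIV. (a $ i)\<^sup>2) - 2 * \<alpha> * \<gamma> * (\<Sum>i\<in>UNIV. (b $ i)\<^sup>2)
      + 2 * \<alpha> * \<beta> * (\<Sum>i\<in>UNIV. (a $ i)\<^sup>2) - 2 * \<gamma> * \<beta> * (a \<bullet> b) * (\<Sum>i\<in>UNIV. a $ i * b $ i)"
    by (simp add: sum.distrib sum_subtractf sum_distrib_left)
  also have "(\<Sum>i\<in>UNIV. (b $ i)\<^sup>2) = B"
    using inner(2) by (simp add: inner_vec_def power2_eq_square)
  also have "(\<Sum>i\<in>UNIV. (a $ i)\<^sup>2) = A"
    using inner(1) by (simp add: inner_vec_def power2_eq_square)
  also have "(\<Sum>i\<in>UNIV. a $ i * b $ i) = a \<bullet> b"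
    by (simp add: inner_vec_def)
  finally have F: "(\<Sum>i\<in>UNIV. (norm (row i D))\<^sup>2) = real CARD('m) * \<alpha>\<^sup>2 + \<gamma>\<^sup>2 * B\<^sup>2 + \<beta>\<^sup>2 * A\<^sup>2
      - 2 * \<alpha> * \<gamma> * B + 2 * \<alpha> * \<beta> * A - 2 * \<gamma> * \<beta> * q"
    by (simp add: inner(3)[symmetric] power2_eq_square mult.assoc)
  have "s\<^sup>2 > 0" "A > 0" "B \<ge> 0" using s a by (auto simp: A_def B_def)
  then show ?thesis
    unfolding Db F \<alpha>_def \<beta>_def \<gamma>_def rank1_gaussian_gap_identity[OF \<open>s\<^sup>2 > 0\<close> \<tau> \<open>A > 0\<close> \<open>B \<ge> 0\<close>]
    by (simp add: fisher_def A_def B_def q_def)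
qed

lemma borel_measurable_matrix_vector_mult [measurable]:
  "(\<lambda>x. M *v x) \<in> borel_measurable borel" for M :: "real^'n^'k"
  by (intro borel_measurable_continuous_onI linear_continuous_on linear_conv_bounded_linear[THEN iffD1])
     simp

text \<open>Both scores are linear in \<open>y\<close>, so their difference is one matrix applied to
  \<open>y\<close> and the integral is a Gaussian second moment.\<close>

lemma nn_integral_score_difference:
  fixes A :: "real^'d^'m"
  assumes s: "s > 0" and v: "norm v = 1" and \<tau>: "\<tau> > 0" and Ae: "A *v e \<noteq> 0"
  shows "(\<integral>\<^sup>+y. ennreal ((norm (teacher_score A e \<tau> y - score (noisy_law A (u, v) s) y))\<^sup>2) \<partial>noisy_law A (u, v) s)
    = ennreal (fisher (A *v e) \<tau> s (A *v u))"
proof -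
  let ?D = "rank1_inv (s\<^sup>2) (A *v u) - rank1_inv \<tau> (A *v e)"
  have "teacher_score A e \<tau> y - score (noisy_law A (u, v) s) y = ?D *v y" for y
    by (simp add: teacher_score_eq[OF \<tau>] score_noisy_law[OF s v] matrix_vector_mult_diff_rdistrib)
  then show ?thesis
    by (simp only:) (simp add: noisy_law_eq_distr nn_integral_distr nn_integral_gaussian_quadratic[OF v]
        fisher_eq[OF s \<tau> Ae])
qed

section \<open>Minimizers\<close>

text \<open>Equality in Cauchy--Schwarz makes \<open>b\<close> parallel to \<open>a\<close>, and the
  norm condition then fixes the factor up to sign.\<close>

lemma norm_collinear_iff:
  fixes a b :: "'a::real_inner"
  assumes a: "a \<noteq> 0" and c: "c \<ge> 0"
  shows "(a \<bullet> b)\<^sup>2 = (norm a)\<^sup>2 * (norm b)\<^sup>2 \<and> norm b = c * norm a \<longleftrightarrow> b = c *\<^sub>R a \<or> b = - (c *\<^sub>R a)"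
proof
  assume *: "(a \<bullet> b)\<^sup>2 = (norm a)\<^sup>2 * (norm b)\<^sup>2 \<and> norm b = c * norm a"
  then have "\<bar>a \<bullet> b\<bar>\<^sup>2 = (norm a * norm b)\<^sup>2"
    by (simp add: power_mult_distrib)
  then have "\<bar>a \<bullet> b\<bar> = norm a * norm b"
    by (rule power2_eq_imp_eq) simp_all
  then have "norm a *\<^sub>R b = norm b *\<^sub>R a \<or> norm a *\<^sub>R b = - norm b *\<^sub>R a"
    by (simp add: norm_cauchy_schwarz_abs_eq)
  then have "norm a *\<^sub>R b = norm a *\<^sub>R (c *\<^sub>R a) \<or> norm a *\<^sub>R b = norm a *\<^sub>R (- (c *\<^sub>R a))"
    using * by (simp add: mult.commute)
  then show "b = c *\<^sub>R a \<or> b = - (c *\<^sub>R a)"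
    using a by (simp only: scaleR_cancel_left) auto
next
  assume "b = c *\<^sub>R a \<or> b = - (c *\<^sub>R a)"
  then show "(a \<bullet> b)\<^sup>2 = (norm a)\<^sup>2 * (norm b)\<^sup>2 \<and> norm b = c * norm a"
    using c by (auto simp: dot_square_norm power2_eq_square)
qed

lemma
  fixes a b :: "real^'m" and \<sigma> s :: real
  assumes s: "s > 0" and \<sigma>: "\<sigma> > 0" and a: "a \<noteq> 0"
  defines "c \<equiv> sqrt (1 + \<sigma>\<^sup>2 / (norm a)\<^sup>2)"
    and "F \<equiv> (real CARD('m) - 1) * s\<^sup>2 * (1 / s\<^sup>2 - 1 / (\<sigma>\<^sup>2 + s\<^sup>2))\<^sup>2"
  shows fisher_eq_min: "b = c *\<^sub>R a \<or> b = - (c *\<^sub>R a) \<Longrightarrow> fisher a (\<sigma>\<^sup>2 + s\<^sup>2) s b = F"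
    and fisher_gt_min: "\<not> (b = c *\<^sub>R a \<or> b = - (c *\<^sub>R a)) \<Longrightarrow> fisher a (\<sigma>\<^sup>2 + s\<^sup>2) s b > F"
proof -
  define A B q where "A = (norm a)\<^sup>2" and "B = (norm b)\<^sup>2" and "q = (a \<bullet> b)\<^sup>2"
  define x y where "x = s\<^sup>2 + B" and "y = \<sigma>\<^sup>2 + s\<^sup>2 + A"
  have pos: "A > 0" "B \<ge> 0"
    using a by (simp_all add: A_def B_def)
  with s have pos: "A > 0" "x > 0" "y > 0"
    by (simp_all add: x_def y_def add_pos_nonneg add_nonneg_pos)
  have cs: "q \<le> A * B"
    using Cauchy_Schwarz_ineq[of a b] by (simp add: q_def A_def B_def power2_norm_eq_inner)
  \<comment> \<open>Strict because \<open>y\<close> exceeds \<sigma>^2 + s^2 by |a|^2 > 0. This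
    positive weight lets the last term of \<open>fisher\<close> detect a failure of
    collinearity.\<close>
  have "1 / (\<sigma>\<^sup>2 + s\<^sup>2)\<^sup>2 > 1 / y\<^sup>2"
    using s pos by (intro divide_strict_left_mono power_strict_mono) (auto simp: y_def intro!: mult_pos_pos add_nonneg_pos)
  then have k: "1 / (\<sigma>\<^sup>2 + s\<^sup>2)\<^sup>2 - 1 / y\<^sup>2 > 0" by simp
  have fisher: "fisher a (\<sigma>\<^sup>2 + s\<^sup>2) s b = F + x * (1 / x - 1 / y)\<^sup>2 + (B - q / A) * (1 / (\<sigma>\<^sup>2 + s\<^sup>2)\<^sup>2 - 1 / y\<^sup>2)"
    by (simp add: fisher_def F_def x_def y_def A_def B_def q_def)
  have qA: "q / A \<le> B" "q / A = B \<longleftrightarrow> q = A * B"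
    using pos(1) cs by (simp_all add: pos_divide_le_eq nonzero_divide_eq_eq mult.commute)
  have "x * (1 / x - 1 / y)\<^sup>2 \<ge> 0" "(B - q / A) * (1 / (\<sigma>\<^sup>2 + s\<^sup>2)\<^sup>2 - 1 / y\<^sup>2) \<ge> 0"
    using pos qA(1) k by (intro mult_nonneg_nonneg; simp)+
  moreover have "x * (1 / x - 1 / y)\<^sup>2 = 0 \<longleftrightarrow> x = y"
    using pos by simp
  moreover have "(B - q / A) * (1 / (\<sigma>\<^sup>2 + s\<^sup>2)\<^sup>2 - 1 / y\<^sup>2) = 0 \<longleftrightarrow> q = A * B"
    using k qA(2) by (simp only: mult_eq_0_iff) auto
  \<comment> \<open>After s^2 cancels, x = y reads |b|^2 = |a|^2 + \<sigma>^2, and \<open>c\<close>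
    is the factor for which c |a| is the square root of the right side.\<close>
  moreover have "x = y \<longleftrightarrow> norm b = c * norm a"
  proof -
    have "c * norm a = sqrt ((1 + \<sigma>\<^sup>2 / A) * A)"
      by (simp add: c_def A_def real_sqrt_mult)
    also have "(1 + \<sigma>\<^sup>2 / A) * A = A + \<sigma>\<^sup>2"
      using pos by (simp add: field_simps)
    finally have "c * norm a = sqrt (A + \<sigma>\<^sup>2)" .
    moreover have "norm b = sqrt B" by (simp add: B_def)
    ultimately show ?thesis by (auto simp: x_def y_def)
  qed
  moreover have "c \<ge> 0" by (simp add: c_def)
  note norm_collinear_iff[OF a this, of b]
  ultimately have iff: "x * (1 / x - 1 / y)\<^sup>2 = 0 \<and> (B - q / A) * (1 / (\<sigma>\<^sup>2 + s\<^sup>2)\<^sup>2 - 1 / y\<^sup>2) = 0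
      \<longleftrightarrow> b = c *\<^sub>R a \<or> b = - (c *\<^sub>R a)"
    and nn: "x * (1 / x - 1 / y)\<^sup>2 \<ge> 0" "(B - q / A) * (1 / (\<sigma>\<^sup>2 + s\<^sup>2)\<^sup>2 - 1 / y\<^sup>2) \<ge> 0"
    unfolding A_def B_def q_def by blast+
  show "fisher a (\<sigma>\<^sup>2 + s\<^sup>2) s b = F" if "b = c *\<^sub>R a \<or> b = - (c *\<^sub>R a)"
    using that iff unfolding fisher by linarith
  show "fisher a (\<sigma>\<^sup>2 + s\<^sup>2) s b > F" if "\<not> (b = c *\<^sub>R a \<or> b = - (c *\<^sub>R a))"
    using that iff nn unfolding fisher by linarith
qed

text \<open>Adding the kernel makes \<open>Theta_star\<close> the full preimage under
  \<open>A\<close> of two points, so membership depends on \<open>u\<close> only through Au, as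
  \<open>fisher\<close> does.\<close>

lemma Theta_star_iff:
  fixes A :: "real^'d^'m" and e u :: "real^'d" and \<sigma> :: real
  defines "c \<equiv> sqrt (1 + \<sigma>\<^sup>2 / (norm (A *v e))\<^sup>2)"
  shows "u \<in> Theta_star A e \<sigma> \<longleftrightarrow> A *v u = c *\<^sub>R (A *v e) \<or> A *v u = - (c *\<^sub>R (A *v e))"
proof
  assume "u \<in> Theta_star A e \<sigma>"
  then show "A *v u = c *\<^sub>R (A *v e) \<or> A *v u = - (c *\<^sub>R (A *v e))"
    by (auto simp: Theta_star_def Let_def c_def matrix_vector_right_distrib matrix_vector_mult_scaleR
        simp flip: scaleR_minus_left)
next
  assume "A *v u = c *\<^sub>R (A *v e) \<or> A *v u = - (c *\<^sub>R (A *v e))"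
  moreover have "A *v (c *\<^sub>R e) = c *\<^sub>R (A *v e)" "A *v (- (c *\<^sub>R e)) = - (c *\<^sub>R (A *v e))"
    by (simp_all only: matrix_vector_mult_scaleR flip: scaleR_minus_left)
  ultimately obtain s where s: "s \<in> {c *\<^sub>R e, - (c *\<^sub>R e)}" "A *v u = A *v s"
    by (metis insertCI)
  then have "u = s + (u - s)" "A *v (u - s) = 0"
    by (simp_all add: matrix_vector_mult_diff_distrib)
  with s(1) show "u \<in> Theta_star A e \<sigma>"
    unfolding Theta_star_def Let_def c_def by blast
qed

section \<open>Wasserstein distance of collinear Gaussians\<close>

lemma distr_std_gaussian_line:
  fixes u :: "real^'n" and v :: "real^'d"
  assumes "norm v = 1"
  shows "distr std_gaussian borel (\<lambda>z. (v \<bullet> z) *\<^sub>R u) = distr std_normal_distribution borel (\<lambda>w. w *\<^sub>R u)"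
  by (simp add: distr_std_gaussian_inner[OF assms, symmetric] distr_distr comp_def)

text \<open>The matrix \<open>L\<close> behind \<open>centered_gaussian\<close> is an arbitrary
  choice with LL^T = ee^T. This gives |L^T x| = |e . x|, so L^T vanishes on the orthogonal
  complement of \<open>e\<close>; dually L z = (l . z) e with the unit vector l = L^T e.\<close>

lemma centered_gaussian_rank1:
  fixes e :: "real^'n"
  assumes e: "norm e = 1"
  shows "centered_gaussian (outer e e) = distr std_normal_distribution borel (\<lambda>w. w *\<^sub>R e)"
proof -
  define L :: "real^'n^'n" where "L = (SOME L. L ** transpose L = outer e e)"
  have ee: "e \<bullet> e = 1" using e by (simp add: norm_eq_1)
  have tr: "transpose (outer e e) = outer e e"
    by (simp add: transpose_def outer_def vec_eq_iff mult.commute)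
  \<comment> \<open>The projection ee^T is its own square root and so a witness for the
    choice.\<close>
  have "outer e e ** transpose (outer e e) = outer e e"
    by (simp add: tr matrix_eq matrix_vector_mul_assoc[symmetric] outer_mult_vec ee)
  then have L: "L ** transpose L = outer e e"
    unfolding L_def by (rule someI)
  have adj: "(transpose L *v x) \<bullet> z = x \<bullet> (L *v z)" for x z
    by (simp add: dot_lmul_matrix)
  have norm_adj: "(norm (transpose L *v x))\<^sup>2 = (e \<bullet> x)\<^sup>2" for x
    unfolding power2_norm_eq_inner adj matrix_vector_mul_assoc L outer_mult_vec
    by (simp add: power2_eq_square inner_commute)
  define l where "l = transpose L *v e"
  have l: "norm l = 1"
    using norm_adj[of e] ee by (intro power2_eq_imp_eq[of "norm l" 1]) (simp_all add: l_def)
  have adj_eq: "transpose L *v x = (e \<bullet> x) *\<^sub>R l" for x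
  proof -
    have "(norm (transpose L *v (x - (e \<bullet> x) *\<^sub>R e)))\<^sup>2 = 0"
      unfolding norm_adj by (simp add: inner_diff_right ee)
    then show ?thesis
      by (simp add: l_def matrix_vector_mult_diff_distrib matrix_vector_mult_scaleR)
  qed
  have "L *v z = (l \<bullet> z) *\<^sub>R e" for z
  proof -
    have "x \<bullet> (L *v z) = x \<bullet> ((l \<bullet> z) *\<^sub>R e)" for x
      unfolding adj[symmetric] adj_eq by (simp add: inner_commute)
    then show ?thesis by (subst vector_eq_ldot[symmetric]) blast
  qed
  then have "(*v) L = (\<lambda>z. (l \<bullet> z) *\<^sub>R e)" by (rule ext)
  then show ?thesis
    unfolding centered_gaussian_def L_def[symmetric] by (simp only: distr_std_gaussian_line[OF l])
qed

text \<open>The upper bound is the cost of an explicit coupling, the lower bound a quadratic dual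
  certificate. With \<open>c \<ge> 1\<close> both weights, c - 1 and 1 - 1/c, are nonnegative, so
  the certificate can be integrated in \<open>ennreal\<close>.\<close>

lemma wasserstein2_collinear_gaussians:
  fixes e :: "real^'n"
  assumes e: "norm e = 1" and c: "c \<ge> 1"
  shows "(wasserstein2 (distr std_normal_distribution borel (\<lambda>w. w *\<^sub>R e))
            (distr std_normal_distribution borel (\<lambda>w. w *\<^sub>R (c *\<^sub>R e))))\<^sup>2 = (c - 1)\<^sup>2"
proof -
  let ?P = "distr std_normal_distribution borel (\<lambda>w. w *\<^sub>R e)"
    and ?Q = "distr std_normal_distribution borel (\<lambda>w. w *\<^sub>R (c *\<^sub>R e))"
  let ?cost = "\<lambda>\<pi>. \<integral>\<^sup>+ p. ennreal ((dist (fst p) (snd p :: real^'n))\<^sup>2) \<partial>\<pi>"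
  have sets_PQ: "sets (?P \<Otimes>\<^sub>M ?Q) = sets (borel \<Otimes>\<^sub>M borel)"
    by (intro sets_pair_measure_cong) simp_all
  have moment: "(\<integral>\<^sup>+x. ennreal (k * (norm x)\<^sup>2) \<partial>distr std_normal_distribution borel (\<lambda>w. w *\<^sub>R (r *\<^sub>R e)))
      = ennreal (k * r\<^sup>2)" if "k \<ge> 0" for k r
  proof -
    have "(\<integral>\<^sup>+x. ennreal (k * (norm x)\<^sup>2) \<partial>distr std_normal_distribution borel (\<lambda>w. w *\<^sub>R (r *\<^sub>R e)))
        = (\<integral>\<^sup>+w. ennreal ((0 + (sqrt k * r) * w)\<^sup>2) \<partial>std_normal_distribution)"
      using that e by (simp add: nn_integral_distr power_mult_distrib mult_ac)
    also have "\<dots> = ennreal (k * r\<^sup>2)"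
      unfolding nn_integral_std_normal_sq using that by (simp add: power_mult_distrib)
    finally show ?thesis .
  qed
  have "(INF \<pi>\<in>couplings ?P ?Q. ?cost \<pi>) = ennreal ((c - 1)\<^sup>2)"
  proof (rule antisym)
    let ?f = "\<lambda>w. (w *\<^sub>R e, w *\<^sub>R (c *\<^sub>R e))"
    let ?\<pi> = "distr std_normal_distribution (borel \<Otimes>\<^sub>M borel) ?f"
    have f [measurable]: "?f \<in> std_normal_distribution \<rightarrow>\<^sub>M borel \<Otimes>\<^sub>M borel" by measurable
    have "?\<pi> \<in> couplings ?P ?Q"
      unfolding couplings_def
    proof (intro CollectI conjI)
      show "sets ?\<pi> = sets (?P \<Otimes>\<^sub>M ?Q)" by (simp only: sets_distr sets_PQ)
      \<comment> \<open>As a target of \<open>distr\<close>, a measure matters only through its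
        space and measurable sets, so \<open>?P\<close> and \<open>?Q\<close> can be exchanged for
        \<open>borel\<close>.\<close>
      have "distr ?\<pi> ?P fst = distr ?\<pi> borel fst" "distr ?\<pi> ?Q snd = distr ?\<pi> borel snd"
        by (rule distr_cong; simp)+
      moreover have "distr ?\<pi> borel fst = ?P" "distr ?\<pi> borel snd = ?Q"
        using distr_distr[OF measurable_fst f] distr_distr[OF measurable_snd f] by (simp_all only: comp_def fst_conv snd_conv)
      ultimately show "distr ?\<pi> ?P fst = ?P" "distr ?\<pi> ?Q snd = ?Q"
        by simp_all
    qed
    then have "(INF \<pi>\<in>couplings ?P ?Q. ?cost \<pi>) \<le> ?cost ?\<pi>" by (rule INF_lower)
    also have "?cost ?\<pi> = (\<integral>\<^sup>+w. ennreal ((0 + (c - 1) * w)\<^sup>2) \<partial>std_normal_distribution)"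
    proof -
      have "(dist (w *\<^sub>R e) (w *\<^sub>R (c *\<^sub>R e)))\<^sup>2 = (0 + (c - 1) * w)\<^sup>2" for w
      proof -
        have "w *\<^sub>R e - w *\<^sub>R (c *\<^sub>R e) = (- ((c - 1) * w)) *\<^sub>R e"
          by (simp add: algebra_simps)
        then show ?thesis unfolding dist_norm using e by (simp add: power_mult_distrib)
      qed
      then show ?thesis
        by (subst nn_integral_distr[OF f]) simp_all
    qed
    also have "\<dots> = ennreal ((c - 1)\<^sup>2)" unfolding nn_integral_std_normal_sq by simp
    finally show "(INF \<pi>\<in>couplings ?P ?Q. ?cost \<pi>) \<le> ennreal ((c - 1)\<^sup>2)" .
  next
    show "ennreal ((c - 1)\<^sup>2) \<le> (INF \<pi>\<in>couplings ?P ?Q. ?cost \<pi>)"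
    proof (rule INF_greatest)
      fix \<pi> assume "\<pi> \<in> couplings ?P ?Q"
      then have [measurable_cong]: "sets \<pi> = sets (borel \<Otimes>\<^sub>M borel)"
        and P: "distr \<pi> ?P fst = ?P" and Q: "distr \<pi> ?Q snd = ?Q"
        using sets_PQ by (auto simp: couplings_def)
      have 1: "(\<integral>\<^sup>+p. ennreal ((c - 1) * (norm (fst p))\<^sup>2) \<partial>\<pi>) = ennreal (c - 1)"
      proof -
        have "(\<integral>\<^sup>+p. ennreal ((c - 1) * (norm (fst p))\<^sup>2) \<partial>\<pi>)
            = (\<integral>\<^sup>+x. ennreal ((c - 1) * (norm x)\<^sup>2) \<partial>distr \<pi> ?P fst)"
          by (subst nn_integral_distr) simp_all
        then show ?thesis unfolding P using moment[of "c - 1" 1] c by simp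
      qed
      have 2: "(\<integral>\<^sup>+p. ennreal ((1 - 1 / c) * (norm (snd p))\<^sup>2) \<partial>\<pi>) = ennreal ((1 - 1 / c) * c\<^sup>2)"
      proof -
        have "(\<integral>\<^sup>+p. ennreal ((1 - 1 / c) * (norm (snd p))\<^sup>2) \<partial>\<pi>)
            = (\<integral>\<^sup>+x. ennreal ((1 - 1 / c) * (norm x)\<^sup>2) \<partial>distr \<pi> ?Q snd)"
          by (subst nn_integral_distr) simp_all
        then show ?thesis unfolding Q using moment[of "1 - 1 / c" c] c by simp
      qed
      have "(1 - 1 / c) * (norm y)\<^sup>2 \<le> (dist x y)\<^sup>2 + (c - 1) * (norm x)\<^sup>2" for x y :: "real^'n"
      proof -
        \<comment> \<open>The slack is a square that vanishes for y = c x, the relation that holds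
          on the coupling of the upper bound.\<close>
        have "(dist x y)\<^sup>2 + (c - 1) * (norm x)\<^sup>2 - (1 - 1 / c) * (norm y)\<^sup>2 = (norm (c *\<^sub>R x - y))\<^sup>2 / c"
          unfolding dist_norm power2_norm_eq_inner using c
          by (simp add: inner_diff_left inner_diff_right inner_commute field_simps)
        moreover have "(norm (c *\<^sub>R x - y))\<^sup>2 / c \<ge> 0" using c by simp
        ultimately show ?thesis by linarith
      qed
      then have "(\<integral>\<^sup>+p. ennreal ((1 - 1 / c) * (norm (snd p))\<^sup>2) \<partial>\<pi>)
          \<le> (\<integral>\<^sup>+p. ennreal ((dist (fst p) (snd p))\<^sup>2) + ennreal ((c - 1) * (norm (fst p))\<^sup>2) \<partial>\<pi>)"
        using c by (intro nn_integral_mono) (simp add: ennreal_plus[symmetric] ennreal_leI del: ennreal_plus)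
      also have "\<dots> = ?cost \<pi> + ennreal (c - 1)"
        by (subst nn_integral_add) (simp_all add: 1)
      finally have le: "ennreal ((1 - 1 / c) * c\<^sup>2) \<le> ?cost \<pi> + ennreal (c - 1)"
        unfolding 2 .
      have eq: "(1 - 1 / c) * c\<^sup>2 = (c - 1)\<^sup>2 + (c - 1)"
        using c by (simp add: field_simps power2_eq_square)
      show "ennreal ((c - 1)\<^sup>2) \<le> ?cost \<pi>"
      \<comment> \<open>The finite summand \<open>c - 1\<close> is cancelled when the cost is
        finite; an infinite cost is trivial.\<close>
      proof (cases "?cost \<pi>")
        case (real r)
        then show ?thesis
          using le c unfolding eq by (simp add: ennreal_plus[symmetric] del: ennreal_plus)
      qed simp
    qed
  qed
  then show ?thesis by (simp add: wasserstein2_def)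
qed

text \<open>The unit vector u / |u| changes sign together with \<open>u\<close>, so both signs give
  the same generator.\<close>

lemma generator_law_line:
  fixes e :: "real^'d"
  assumes e: "norm e = 1" and c: "c > 0" and u: "u = c *\<^sub>R e \<or> u = - (c *\<^sub>R e)"
  shows "generator_law (theta_of u) = distr std_normal_distribution borel (\<lambda>w. w *\<^sub>R (c *\<^sub>R e))"
proof -
  obtain \<delta> :: real where \<delta>: "u = (\<delta> * c) *\<^sub>R e" "\<delta> = 1 \<or> \<delta> = - 1"
    using u by (metis mult_1 mult_minus1 scaleR_minus_left)
  then have "norm u = c" using e c by auto
  then have "generator (theta_of u) z = (e \<bullet> z) *\<^sub>R (c *\<^sub>R e)" for z
    using \<delta> c by (auto simp: generator_def theta_of_def outer_mult_vec)
  then have "generator (theta_of u) = (\<lambda>z. (e \<bullet> z) *\<^sub>R (c *\<^sub>R e))" by (rule ext)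
  then show ?thesis
    unfolding generator_law_def by (simp only: distr_std_gaussian_line[OF e])
qed

theorem theorem2:
  fixes A :: "real^'d^'m" and e :: "real^'d"
    and \<sigma> \<sigma>_min \<sigma>_max :: real and \<sigma>t :: "real \<Rightarrow> real"
  assumes "\<sigma> > 0"
    and "CARD('d) \<ge> 2"
    and "rank A = CARD('m)"
    and "norm e = 1"
    and "A *v e \<noteq> 0"
    and "0 < \<sigma>_min" and "\<sigma>_min < \<sigma>_max"
    and "\<sigma>t \<in> borel_measurable (lebesgue_on {0..1})"
    and "\<forall>t\<in>{0..1}. \<sigma>t t \<in> {\<sigma>_min..\<sigma>_max}"
  shows "{u. is_arg_min (\<lambda>u. distillation_loss A e \<sigma> \<sigma>t (theta_of u)) (\<lambda>u. u \<noteq> 0) u}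
           = Theta_star A e \<sigma>
       \<and> (e \<in> range ((*v) (transpose A)) \<longrightarrow>
           (\<forall>u. is_arg_min norm (\<lambda>u. u \<in> Theta_star A e \<sigma>) u \<longrightarrow>
              (wasserstein2 (centered_gaussian (outer e e)) (generator_law (theta_of u)))\<^sup>2
                = (sqrt (1 + \<sigma>\<^sup>2 / (norm (A *v e))\<^sup>2) - 1)\<^sup>2))"
proof -
  define a where "a = A *v e"
  define c where "c = sqrt (1 + \<sigma>\<^sup>2 / (norm a)\<^sup>2)"
  define F where "F s = (real CARD('m) - 1) * s\<^sup>2 * (1 / s\<^sup>2 - 1 / (\<sigma>\<^sup>2 + s\<^sup>2))\<^sup>2" for s
  define L where "L u = distillation_loss A e \<sigma> \<sigma>t (theta_of u)" for u
  have a: "a \<noteq> 0" using assms by (simp add: a_def)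
  have c: "c \<ge> 1" by (simp add: c_def)
  have Theta: "u \<in> Theta_star A e \<sigma> \<longleftrightarrow> A *v u = c *\<^sub>R a \<or> A *v u = - (c *\<^sub>R a)" for u
    unfolding c_def a_def by (rule Theta_star_iff)
  have Theta_nz: "u \<noteq> 0" if "u \<in> Theta_star A e \<sigma>" for u
    using that a c by (auto simp: Theta)
  have st: "\<sigma>t t > 0" "\<sigma>t t \<ge> \<sigma>_min" if "t \<in> {0..1}" for t
    using assms(6,9) that by fastforce+
  have [measurable]: "\<sigma>t \<in> borel_measurable (lebesgue_on {0..1})" by fact
  \<comment> \<open>For \<open>u \<noteq> 0\<close> the second component of
    \<open>theta_of u\<close> is a unit vector, so the loss is an integral of \<open>fisher\<close>
    and sees \<open>u\<close> only through Au.\<close>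
  have L: "L u = (\<integral>\<^sup>+t. ennreal (fisher a (\<sigma>\<^sup>2 + (\<sigma>t t)\<^sup>2) (\<sigma>t t) (A *v u)) \<partial>lebesgue_on {0..1})"
    if "u \<noteq> 0" for u
    unfolding L_def distillation_loss_def
  proof (rule nn_integral_cong)
    fix t assume "t \<in> space (lebesgue_on {0..1::real})"
    then have "\<sigma>t t > 0" using st by simp
    moreover have "norm (u /\<^sub>R norm u) = 1" using that by simp
    ultimately show "(\<integral>\<^sup>+y. ennreal ((norm (teacher_score A e (\<sigma>\<^sup>2 + (\<sigma>t t)\<^sup>2) y
          - score (noisy_law A (theta_of u) (\<sigma>t t)) y))\<^sup>2) \<partial>noisy_law A (theta_of u) (\<sigma>t t))
      = ennreal (fisher a (\<sigma>\<^sup>2 + (\<sigma>t t)\<^sup>2) (\<sigma>t t) (A *v u))"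
      unfolding theta_of_def a_def using assms(1,5)
      by (intro nn_integral_score_difference) (auto intro: add_pos_pos)
  qed
  \<comment> \<open>The minimal value: the integral of the part of \<open>fisher\<close> that is
    independent of \<open>u\<close>.\<close>
  define L0 where "L0 = (\<integral>\<^sup>+t. ennreal (F (\<sigma>t t)) \<partial>lebesgue_on {0..1})"
  have unit: "emeasure (lebesgue_on {0..1::real}) {0..1} = 1"
    by (subst emeasure_restrict_space) auto
  \<comment> \<open>Strict comparison of integrals below relies on finiteness; the lower bound
    \<open>\<sigma>_min\<close> of the schedule keeps \<open>F\<close> bounded.\<close>
  have L0_finite: "L0 \<noteq> \<infinity>"
  proof -
    define K where "K = (real CARD('m) - 1) / \<sigma>_min\<^sup>2"
    have m: "real CARD('m) - 1 \<ge> 0" by (simp add: Suc_leI)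
    have "F (\<sigma>t t) \<le> K" if "t \<in> {0..1}" for t
    proof -
      define s where "s = \<sigma>t t"
      have s: "s > 0" "\<sigma>_min \<le> s" using st[OF that] by (simp_all add: s_def)
      have "0 \<le> 1 / s\<^sup>2 - 1 / (\<sigma>\<^sup>2 + s\<^sup>2)" "1 / s\<^sup>2 - 1 / (\<sigma>\<^sup>2 + s\<^sup>2) \<le> 1 / s\<^sup>2"
        using s assms(1) by (auto simp: frac_le)
      then have "(1 / s\<^sup>2 - 1 / (\<sigma>\<^sup>2 + s\<^sup>2))\<^sup>2 \<le> (1 / s\<^sup>2)\<^sup>2"
        by (intro power_mono)
      then have "s\<^sup>2 * (1 / s\<^sup>2 - 1 / (\<sigma>\<^sup>2 + s\<^sup>2))\<^sup>2 \<le> s\<^sup>2 * (1 / s\<^sup>2)\<^sup>2"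
        by (intro mult_left_mono) auto
      also have "\<dots> = 1 / s\<^sup>2" using s by (simp add: power2_eq_square)
      also have "\<dots> \<le> 1 / \<sigma>_min\<^sup>2"
        using s assms(6) by (intro divide_left_mono power_mono) auto
      finally have "(real CARD('m) - 1) * (s\<^sup>2 * (1 / s\<^sup>2 - 1 / (\<sigma>\<^sup>2 + s\<^sup>2))\<^sup>2)
          \<le> (real CARD('m) - 1) * (1 / \<sigma>_min\<^sup>2)"
        using m by (rule mult_left_mono)
      then show ?thesis by (simp add: F_def K_def s_def mult.assoc)
    qed
    then have "L0 \<le> (\<integral>\<^sup>+t. ennreal K \<partial>lebesgue_on {0..1::real})"
      unfolding L0_def by (intro nn_integral_mono) (simp add: ennreal_leI)
    also have "\<dots> = ennreal K" using unit by simp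
    finally have "L0 < \<infinity>" by (rule le_less_trans) simp
    then show ?thesis by simp
  qed
  have L_min: "L u = L0" if "u \<in> Theta_star A e \<sigma>" for u
    unfolding L[OF Theta_nz[OF that]] L0_def
    using that[unfolded Theta] st assms(1) a
    by (intro nn_integral_cong) (simp add: F_def fisher_eq_min[of _ \<sigma> a] c_def)
  have L_gt: "L0 < L u" if "u \<noteq> 0" "u \<notin> Theta_star A e \<sigma>" for u
  proof -
    have gt: "F (\<sigma>t t) < fisher a (\<sigma>\<^sup>2 + (\<sigma>t t)\<^sup>2) (\<sigma>t t) (A *v u)" if "t \<in> {0..1}" for t
      unfolding F_def using st(1)[OF that] assms(1) a \<open>u \<notin> _\<close>[unfolded Theta c_def]
      by (rule fisher_gt_min)
    have "F s \<ge> 0" for s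
      by (simp add: F_def Suc_leI)
    then have gt': "ennreal (F (\<sigma>t t)) < ennreal (fisher a (\<sigma>\<^sup>2 + (\<sigma>t t)\<^sup>2) (\<sigma>t t) (A *v u))"
      if "t \<in> {0..1}" for t
      using gt[OF that] by (simp add: ennreal_less_iff)
    show ?thesis
      unfolding L0_def L[OF that(1)]
    proof (rule nn_integral_less)
      show "(\<lambda>t. ennreal (F (\<sigma>t t))) \<in> borel_measurable (lebesgue_on {0..1})"
        unfolding F_def by measurable
      show "(\<lambda>t. ennreal (fisher a (\<sigma>\<^sup>2 + (\<sigma>t t)\<^sup>2) (\<sigma>t t) (A *v u))) \<in> borel_measurable (lebesgue_on {0..1})"
        unfolding fisher_def by measurable
      show "(\<integral>\<^sup>+t. ennreal (F (\<sigma>t t)) \<partial>lebesgue_on {0..1}) \<noteq> \<infinity>"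
        using L0_finite by (simp add: L0_def)
      show "AE t in lebesgue_on {0..1}. ennreal (F (\<sigma>t t)) \<le> ennreal (fisher a (\<sigma>\<^sup>2 + (\<sigma>t t)\<^sup>2) (\<sigma>t t) (A *v u))"
        using gt' by (intro AE_I2) (simp add: less_imp_le)
      show "\<not> (AE t in lebesgue_on {0..1}. ennreal (fisher a (\<sigma>\<^sup>2 + (\<sigma>t t)\<^sup>2) (\<sigma>t t) (A *v u)) \<le> ennreal (F (\<sigma>t t)))"
      proof
        assume "AE t in lebesgue_on {0..1}. ennreal (fisher a (\<sigma>\<^sup>2 + (\<sigma>t t)\<^sup>2) (\<sigma>t t) (A *v u)) \<le> ennreal (F (\<sigma>t t))"
        moreover have "AE t in lebesgue_on {0..1}. ennreal (F (\<sigma>t t)) < ennreal (fisher a (\<sigma>\<^sup>2 + (\<sigma>t t)\<^sup>2) (\<sigma>t t) (A *v u))"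
          using gt' by (intro AE_I2) simp
        \<comment> \<open>Two contradictory inequalities hold almost everywhere, so [0,1] would be a
          null set, although its mass is 1.\<close>
        ultimately have "AE t in lebesgue_on {0..1::real}. False"
          by eventually_elim simp
        then obtain N where N: "{x \<in> space (lebesgue_on {0..1::real}). \<not> False} \<subseteq> N" "emeasure (lebesgue_on {0..1::real}) N = 0"
          "N \<in> sets (lebesgue_on {0..1::real})"
          by (rule AE_E)
        from N(1) have "{0..1} \<subseteq> N" by auto
        from emeasure_mono[OF this N(3)] show False using unit N(2) by simp
      qed
    qed
  qed
  \<comment> \<open>This point is the competitor twice: in the loss, to exclude points outside
    \<open>Theta_star\<close>, and in the norm, to bound a minimum norm solution.\<close>
  have ce: "c *\<^sub>R e \<in> Theta_star A e \<sigma>"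
    by (simp add: Theta a_def matrix_vector_mult_scaleR)
  have "{u. is_arg_min L (\<lambda>u. u \<noteq> 0) u} = Theta_star A e \<sigma>"
  proof (intro set_eqI iffI)
    fix u assume "u \<in> {u. is_arg_min L (\<lambda>u. u \<noteq> 0) u}"
    then have u: "u \<noteq> 0" "\<not> L (c *\<^sub>R e) < L u"
      using Theta_nz[OF ce] unfolding is_arg_min_def by blast+
    then show "u \<in> Theta_star A e \<sigma>" using L_gt[of u] L_min[OF ce] by auto
  next
    fix u assume u: "u \<in> Theta_star A e \<sigma>"
    have "\<not> L y < L u" if "y \<noteq> 0" for y
      using L_min[OF u] L_min[of y] L_gt[OF that] by (cases "y \<in> Theta_star A e \<sigma>") auto
    then show "u \<in> {u. is_arg_min L (\<lambda>u. u \<noteq> 0) u}"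
      using Theta_nz[OF u] by (auto simp: is_arg_min_def)
  qed
  moreover have "(wasserstein2 (centered_gaussian (outer e e)) (generator_law (theta_of u)))\<^sup>2 = (c - 1)\<^sup>2"
    if e_range: "e \<in> range ((*v) (transpose A))" and u: "is_arg_min norm (\<lambda>u. u \<in> Theta_star A e \<sigma>) u" for u
  proof -
    obtain w where w: "e = transpose A *v w" using e_range by auto
    from u obtain s q where s: "u = s + q" "s = c *\<^sub>R e \<or> s = - (c *\<^sub>R e)" "A *v q = 0"
      by (auto simp: is_arg_min_def Theta_star_def Let_def c_def a_def)
    \<comment> \<open>A vector in the range of A^T is orthogonal to ker A. Pythagoras then gives
      |u|^2 = c^2 + |q|^2, and comparison with \<open>c *\<^sub>R e\<close> forces q = 0.\<close>
    have "e \<bullet> q = w \<bullet> (A *v q)" unfolding w by (simp add: dot_lmul_matrix)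
    then have "s \<bullet> q = 0" using s by auto
    then have "(norm u)\<^sup>2 = (norm s)\<^sup>2 + (norm q)\<^sup>2"
      unfolding s(1) power2_norm_eq_inner by (simp add: inner_add_left inner_add_right inner_commute)
    moreover have "norm s = norm (c *\<^sub>R e)" using s(2) by auto
    moreover have "norm u \<le> norm (c *\<^sub>R e)" using u ce by (force simp: is_arg_min_def)
    ultimately have "(norm q)\<^sup>2 \<le> 0"
      using power_mono[of "norm u" "norm (c *\<^sub>R e)" 2] by simp
    then have "u = c *\<^sub>R e \<or> u = - (c *\<^sub>R e)" using s by auto
    then have "generator_law (theta_of u) = distr std_normal_distribution borel (\<lambda>w. w *\<^sub>R (c *\<^sub>R e))"
      using c by (intro generator_law_line[OF assms(4)]) auto
    then show ?thesis
      by (simp only: centered_gaussian_rank1[OF assms(4)] wasserstein2_collinear_gaussians[OF assms(4) c])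
  qed
  ultimately show ?thesis
    unfolding L_def c_def a_def by blast
qed

end
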